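(* Let $r:[0,\bar\epsilon)\to\mathbb{R}$ be a continuously differentiable function with $r(\epsilon)\neq 0$ for $\epsilon\neq 0$ and $\lim_{\epsilon\to 0}r(\epsilon)=r(0)=\hat r$, where $1/\hat r^2\in\mathsf{Hyp}$ (with the convention $1/0=\infty$). Consider the family of Hénon maps $H_{1/\epsilon^2,\,r(\epsilon)/\epsilon}$, $0<\epsilon<\bar\epsilon$. Then: (i) Every $\mathbf{x}^\dag\in\Sigma_{0,\hat r}$ is a non-degenerate zero of $F(\cdot;0)$. Hence, for every $\mathbf{x}^\dag\in\Sigma_{0,\hat r}$ there exist positive constants $\epsilon_0,\delta_0$ such that, for every $0\le\epsilon<\epsilon_0$, there is a unique $\mathbf{x}^*=\mathbf{x}^*(\epsilon;\mathbf{x}^\dag)\in\Sigma_\epsilon$ with $|x_i^*-x_i^\dag|<\delta_0$ for all $i\in\mathbb{Z}$. (ii) The constants $\epsilon_0,\delta_0$ can be taken independent of $\mathbf{x}^\dag\in\Sigma_{0,\hat r}$, and in such a way that, for every $0<\epsilon<\epsilon_0$, the set $$\mathcal{A}_\epsilon:=\{(x_0^*,x_{-1}^* ) : \mathbf{x}^*=\mathbf{x}^*(\epsilon;\mathbf{x}^\dag),\ \mathbf{x}^\dag\in\Sigma_{0,\hat r}\}\subset\mathbb{R}^2$$ is compact and invariant under $H_{1/\epsilon^2,r(\epsilon)/\epsilon}$, and the restriction of $H_{1/\epsilon^2,r(\epsilon)/\epsilon}$ to $\mathcal{A}_\epsilon$ is topologically conjugate to the left shift $\sigma$ on $\Sigma_{0,\hat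 r}$ (with the product topology). (iii) As $\epsilon\to 0$, $x_i^*(\epsilon;\mathbf{x}^\dag)\to x_i^\dag$ for all $i\in\mathbb{Z}$ and all $\mathbf{x}^\dag\in\Sigma_{0,\hat r}$, and $\mathcal{A}_\epsilon\to\mathcal{A}_0:=\{(x_0,x_{-1}):\mathbf{x}\in\Sigma_{0,\hat r}\}$ in the Hausdorff topology.
   Context: Hénon map: $H_{a,b}(x,y)=(\sqrt a(1-x^2)-by,\;x)$ on $\mathbb{R}^2$, $a>0$, $b\ne0$. Quadratic map: $Q_a(x)=\sqrt a(1-x^2)$ on $\mathbb{R}$, $a>0$. $Q_a$ is called hyperbolic if it has an attracting periodic orbit (multiplier of modulus $<1$) or if its critical point $0$ goes to infinity under iteration. $\mathsf{Hyp}:=\{a>0: Q_a\text{ is hyperbolic}\}\cup\{\infty\}$. For hyperbolic $Q_a$ with $a>2$, $\Lambda_a$ is the set of points with bounded forward orbit under $Q_a$. For hyperbolic $Q_a$ with $0<a<2$ (so there is an attracting periodic orbit), $\Lambda_a$ is the set of points with bounded forward orbit that do not lie in the basin of attraction of the attracting periodic orbit. $\Lambda_\infty:=\{-1,1\}$. $l_\infty(\mathbb{Z},\mathbb{R})$ is the Banach space of bounded bi-infinite real sequences $\mathbf{x}=(x_i)_{i\in\mathbb{Z}}$ with the supremum norm. Define $F(\cdot;\epsilon):l_\infty(\mathbb{Z},\mathbb{R})\to l_\infty(\mathbb{Z},\mathbb{R})$ by $F_i(\mathbf{x};\epsilon)=\epsilon x_{i+1}-(1-x_i^2)+r(\epsilon)x_{i-1}$,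 $i\in\mathbb{Z}$, with $r(0)=\hat r$. A zero $\mathbf{x}$ of $F(\cdot;\epsilon)$ is non-degenerate if the derivative $DF(\mathbf{x};\epsilon):l_\infty(\mathbb{Z},\mathbb{R})\to l_\infty(\mathbb{Z},\mathbb{R})$ with respect to $\mathbf{x}$ is invertible. Put $\Sigma_\epsilon:=\{\mathbf{x}\in l_\infty(\mathbb{Z},\mathbb{R}):F(\mathbf{x};\epsilon)=0\}$ and $\Sigma_{0,\hat r}:=\{\mathbf{x}\in l_\infty(\mathbb{Z},\mathbb{R}):F(\mathbf{x};0)=0\text{ and }x_i\in\Lambda_{1/\hat r^2}\ \forall i\in\mathbb{Z}\}$; in particular $\Sigma_{0,0}=\{-1,1\}^{\mathbb{Z}}$. $\sigma$ is the left shift, $\sigma(\mathbf{x})_i=x_{i+1}$. *)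

theory Defs
  imports "HOL-Analysis.Analysis"
begin

definition henon :: "real \<Rightarrow> real \<Rightarrow> real \<times> real \<Rightarrow> real \<times> real" where
  "henon a b = (\<lambda>(x, y). (sqrt a * (1 - x\<^sup>2) - b * y, x))"

definition quad :: "real \<Rightarrow> real \<Rightarrow> real" where
  "quad a x = sqrt a * (1 - x\<^sup>2)"

definition has_least_period :: "('a \<Rightarrow> 'a) \<Rightarrow> 'a \<Rightarrow> nat \<Rightarrow> bool" where
  "has_least_period f p n \<longleftrightarrow>
     0 < n \<and> (f ^^ n) p = p \<and> (\<forall>k. 0 < k \<and> k < n \<longrightarrow> (f ^^ k) p \<noteq> p)"

definition attracting_periodic_point :: "(real \<Rightarrow> real) \<Rightarrow> real \<Rightarrow> bool" where
  "attracting_periodic_point f p \<longleftrightarrow>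
     (\<exists>n. has_least_period f p n \<and> \<bar>deriv (f ^^ n) p\<bar> < 1)"

definition forward_orbit :: "('a \<Rightarrow> 'a) \<Rightarrow> 'a \<Rightarrow> 'a set" where
  "forward_orbit f x = range (\<lambda>n. (f ^^ n) x)"

definition basin :: "('a::metric_space \<Rightarrow> 'a) \<Rightarrow> 'a set \<Rightarrow> 'a set" where
  "basin f S = {x. (\<lambda>n. infdist ((f ^^ n) x) S) \<longlonglongrightarrow> 0}"

definition quad_hyperbolic :: "real \<Rightarrow> bool" where
  "quad_hyperbolic a \<longleftrightarrow>
     (\<exists>p. attracting_periodic_point (quad a) p) \<or>
     filterlim (\<lambda>n. (quad a ^^ n) 0) at_infinity sequentially"

definition Hyp :: "ereal set" where
  "Hyp = {ereal a | a. 0 < a \<and> quad_hyperbolic a} \<union> {\<infinity>}"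

(* Meant for hyperbolic a > 0.  The parameter a = 2 is not hyperbolic, so the "else" branch is
   relevant for 0 < a < 2 only.  There the attracting periodic orbit is unique, hence removing the
   basins of all attracting periodic orbits is removing the basin of the one that exists. *)
definition quad_repeller :: "real \<Rightarrow> real set" where
  "quad_repeller a =
     (if a > 2 then {x. bounded (forward_orbit (quad a) x)}
      else {x. bounded (forward_orbit (quad a) x) \<and>
               (\<forall>p. attracting_periodic_point (quad a) p \<longrightarrow>
                    x \<notin> basin (quad a) (forward_orbit (quad a) p))})"

definition Lambda_set :: "ereal \<Rightarrow> real set" where
  "Lambda_set e = (if e = \<infinity> then {-1, 1} else quad_repeller (real_of_ereal e))"

(* The topology of int is discrete, so every function on int is continuous, and bounded continuous
   functions with the supremum norm are exactly the bounded bi-infinite sequences. *)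
type_synonym linf = "int \<Rightarrow>\<^sub>C real"

definition F :: "(real \<Rightarrow> real) \<Rightarrow> real \<Rightarrow> linf \<Rightarrow> linf" where
  "F r \<epsilon> x = Bcontfun (\<lambda>i. \<epsilon> * x (i + 1) - (1 - (x i)\<^sup>2) + r \<epsilon> * x (i - 1))"

lemma F_apply: "F r \<epsilon> x i = \<epsilon> * x (i + 1) - (1 - (x i)\<^sup>2) + r \<epsilon> * x (i - 1)"
proof -
  obtain B where B: "\<And>i. \<bar>x i\<bar> \<le> B"
    using bounded_apply_bcontfun[of x] by (auto simp: bounded_iff)
  have "norm (\<epsilon> * x (i + 1) - (1 - (x i)\<^sup>2) + r \<epsilon> * x (i - 1))
      \<le> \<bar>\<epsilon>\<bar> * B + (1 + B\<^sup>2) + \<bar>r \<epsilon>\<bar> * B" for i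
  proof -
    have "\<bar>\<epsilon> * x (i + 1)\<bar> \<le> \<bar>\<epsilon>\<bar> * B" "\<bar>r \<epsilon> * x (i - 1)\<bar> \<le> \<bar>r \<epsilon>\<bar> * B"
      using B by (auto simp: abs_mult intro!: mult_left_mono)
    moreover have "(x i)\<^sup>2 \<le> B\<^sup>2"
      using B[of i] by (metis abs_ge_zero power2_abs power_mono)
    moreover have "0 \<le> (x i)\<^sup>2"
      by simp
    ultimately show ?thesis
      unfolding real_norm_def by linarith
  qed
  then have "bounded (range (\<lambda>i. \<epsilon> * x (i + 1) - (1 - (x i)\<^sup>2) + r \<epsilon> * x (i - 1)))"
    unfolding bounded_iff by blast
  then have "(\<lambda>i. \<epsilon> * x (i + 1) - (1 - (x i)\<^sup>2) + r \<epsilon> * x (i - 1)) \<in> bcontfun"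
    by (simp add: bcontfun_def)
  then show ?thesis
    by (simp add: F_def Bcontfun_inverse)
qed

definition nondegenerate_zero ::
    "('a::real_normed_vector \<Rightarrow> 'b::real_normed_vector) \<Rightarrow> 'a \<Rightarrow> bool" where
  "nondegenerate_zero G x \<longleftrightarrow>
     G x = 0 \<and>
     (\<exists>D E. (G has_derivative D) (at x) \<and> bounded_linear E \<and> D \<circ> E = id \<and> E \<circ> D = id)"

definition zeros :: "(real \<Rightarrow> real) \<Rightarrow> real \<Rightarrow> linf set" where
  "zeros r \<epsilon> = {x. F r \<epsilon> x = 0}"

definition zeros0 :: "(real \<Rightarrow> real) \<Rightarrow> linf set" where
  "zeros0 r = {x. F r 0 x = 0 \<and> (\<forall>i. x i \<in> Lambda_set (1 / (ereal (r 0))\<^sup>2))}"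

(* Acts on plain functions, whose class topology is the product topology; the bounded sequences
   above carry the norm topology instead. *)
definition shift :: "(int \<Rightarrow> 'a) \<Rightarrow> int \<Rightarrow> 'a" where
  "shift x = (\<lambda>i. x (i + 1))"

(* Meaningful where such an x exists uniquely. *)
definition continuation :: "(real \<Rightarrow> real) \<Rightarrow> real \<Rightarrow> real \<Rightarrow> linf \<Rightarrow> linf" where
  "continuation r \<delta> \<epsilon> xd = (THE x. x \<in> zeros r \<epsilon> \<and> (\<forall>i. \<bar>x i - xd i\<bar> < \<delta>))"

definition A_set :: "(real \<Rightarrow> real) \<Rightarrow> real \<Rightarrow> real \<Rightarrow> (real \<times> real) set" where
  "A_set r \<delta> \<epsilon> = (\<lambda>x :: linf. (x 0, x (-1))) ` continuation r \<delta> \<epsilon> ` zeros0 r"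

definition A0_set :: "(real \<Rightarrow> real) \<Rightarrow> (real \<times> real) set" where
  "A0_set r = (\<lambda>x :: linf. (x 0, x (-1))) ` zeros0 r"

definition topologically_conjugate_on ::
    "('a::topological_space \<Rightarrow> 'a) \<Rightarrow> 'a set \<Rightarrow> ('b::topological_space \<Rightarrow> 'b) \<Rightarrow> 'b set \<Rightarrow> bool" where
  "topologically_conjugate_on f S g T \<longleftrightarrow>
     f ` S \<subseteq> S \<and> g ` T \<subseteq> T \<and>
     (\<exists>h k. homeomorphism S T h k \<and> (\<forall>x\<in>S. h (f x) = g (h x)))"

(* Values in [0, \<infinity>], so no boundedness or nonemptiness has to be presupposed. *)
definition hausdorff_distance :: "'a::metric_space set \<Rightarrow> 'a set \<Rightarrow> ereal" where
  "hausdorff_distance S T =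
     Inf {ereal \<eta> | \<eta>. 0 < \<eta> \<and> S \<subseteq> (\<Union>t\<in>T. ball t \<eta>) \<and> T \<subseteq> (\<Union>s\<in>S. ball s \<eta>)}"

end

theory Submission
  imports Defs
begin

text \<open>Let \<open>P\<close> be a closed forward invariant set containing the critical point \<open>0\<close>, and give a point \<open>x\<close>
in a bounded gap \<open>(l, r)\<close> of \<open>P\<close> the one-dimensional Poincare density \<open>1 / (x - l) + 1 / (r - x)\<close>. An
explicit computation shows that the quadratic map strictly expands this density. With \<open>P\<close> the closure
of the critical orbit together with an escaping orbit, expansion at an attracting periodic orbit is
impossible, so that orbit attracts the critical point; then \<open>P\<close> is disjoint from the repeller, which is
therefore uniformly expanding with respect to the density.

In the supremum norm weighted by the density, the equation for a zero near a singular orbit becomes a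
contraction, uniformly in the singular orbit. Uniqueness of the zeros makes the continuation commute
with the shift and, by a compactness argument on its graph, a homeomorphism.\<close>

subsection \<open>Expansion of the gap density\<close>

text \<open>At \<open>\<epsilon> = 0\<close> the equation reads
  \<open>rh * x (i - 1) = 1 - (x i)\<^sup>2\<close>, so up to a sign the quadratic map runs against
  the index. As it expands, the linearised equation has to be solved for \<open>v i\<close> in terms
  of \<open>v (i - 1)\<close>. Hyperbolicity in the usual sense gives expansion of high iterates
  only; a density that grows at every single step makes one application of the recurrence a
  contraction, with constants that depend on the repeller alone. Forward invariance of
  \<open>P\<close> is what makes the density grow: the gap around \<open>quad a x\<close> pulls back
  to intervals free of \<open>P\<close>, so the gap around \<open>x\<close> contains such an
  interval, and a larger gap has a smaller density. Having the critical point in \<open>P\<close>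
  puts the maximum \<open>sqrt a\<close> of the map into \<open>P\<close>, so that each of these
  intervals is a monotone branch over the whole gap. The escaping orbit bounds the gaps: the
  repeller lies between its first two points.\<close>

definition gap_left :: "real set \<Rightarrow> real \<Rightarrow> real" where
  "gap_left P x = Sup {p \<in> P. p \<le> x}"

definition gap_right :: "real set \<Rightarrow> real \<Rightarrow> real" where
  "gap_right P x = Inf {p \<in> P. x \<le> p}"

text \<open>This is the derivative of \<open>ln ((x - l) / (r - x))\<close> for the gap
  \<open>(l, r)\<close> around \<open>x\<close>, so lengths are logarithms of cross ratios. Without
  points of \<open>P\<close> on both sides of \<open>x\<close>, \<open>Sup\<close> or
  \<open>Inf\<close> of an empty set enters; the lemmas below therefore ask for such points.\<close>

definition gap_density :: "real set \<Rightarrow> real \<Rightarrow> real" where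
  "gap_density P x = 1 / (x - gap_left P x) + 1 / (gap_right P x - x)"

lemma gap_left_props:
  assumes "closed P" "x \<notin> P" "p \<in> P" "p < x"
  shows "gap_left P x \<in> P" "gap_left P x < x" "\<And>q. q \<in> P \<Longrightarrow> q < x \<Longrightarrow> q \<le> gap_left P x"
proof -
  have "{p \<in> P. p \<le> x} = P \<inter> {..x}"
    by auto
  then have cl: "closed {p \<in> P. p \<le> x}"
    using assms(1) by (simp add: closed_Int)
  have bdd: "bdd_above {p \<in> P. p \<le> x}"
    by (rule bdd_aboveI[of _ x]) auto
  have "{p \<in> P. p \<le> x} \<noteq> {}"
    using assms by force
  with cl bdd have "gap_left P x \<in> {p \<in> P. p \<le> x}"
    unfolding gap_left_def by (intro closed_contains_Sup)
  then show *: "gap_left P x \<in> P" "gap_left P x < x"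
    using assms(2) by (auto simp: less_le)
  show "q \<le> gap_left P x" if "q \<in> P" "q < x" for q
    unfolding gap_left_def using that by (intro cSup_upper bdd) auto
qed

lemma gap_right_props:
  assumes "closed P" "x \<notin> P" "p \<in> P" "x < p"
  shows "gap_right P x \<in> P" "x < gap_right P x" "\<And>q. q \<in> P \<Longrightarrow> x < q \<Longrightarrow> gap_right P x \<le> q"
proof -
  have "{p \<in> P. x \<le> p} = P \<inter> {x..}"
    by auto
  then have cl: "closed {p \<in> P. x \<le> p}"
    using assms(1) by (simp add: closed_Int)
  have bdd: "bdd_below {p \<in> P. x \<le> p}"
    by (rule bdd_belowI[of _ x]) auto
  have "{p \<in> P. x \<le> p} \<noteq> {}"
    using assms by force
  with cl bdd have "gap_right P x \<in> {p \<in> P. x \<le> p}"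
    unfolding gap_right_def by (intro closed_contains_Inf)
  then show *: "gap_right P x \<in> P" "x < gap_right P x"
    using assms(2) by (auto simp: less_le)
  show "gap_right P x \<le> q" if "q \<in> P" "x < q" for q
    unfolding gap_right_def using that by (intro cInf_lower bdd) auto
qed

lemma quad_uminus [simp]: "quad a (- x) = quad a x"
  by (simp add: quad_def)

lemma has_derivative_quad: "(quad a has_real_derivative - 2 * sqrt a * x) (at x)"
  unfolding quad_def by (auto intro!: derivative_eq_intros)

lemma continuous_quad: "continuous_on S (quad a)"
  unfolding quad_def by (intro continuous_intros)

text \<open>On the branch from \<open>(u, w)\<close> to \<open>(l, r)\<close> the differences
  \<open>y - l\<close> and \<open>r - y\<close> factor, and the two densities differ by exactly the
  factor \<open>1 + q\<close> with \<open>q = (t - u) * (w - t) / ((t + u) * (w + t))\<close>. The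
  same factorisation gives \<open>q = (r - y) * (y - l) / (s * (t + u) * (w + t))\<^sup>2\<close>.
  The numerator is at least \<open>\<delta>\<^sup>2\<close>; the 16 is the square of the 4 in
  \<open>s * (t + u) * (w + t) \<le> 4 * s * w\<^sup>2 = 4 * (s - l)\<close>.\<close>

lemma gap_density_branch_algebra:
  fixes s t u w x y l r :: real
  assumes "0 < s" "0 \<le> u" "u < t" "t < w" "r = s * (1 - u\<^sup>2)" "l = s * (1 - w\<^sup>2)" "y = s * (1 - t\<^sup>2)"
    and "0 < \<delta>" "\<delta> \<le> y - l" "\<delta> \<le> r - y" "- L \<le> l" "0 \<le> L"
  shows "(1 + \<delta>\<^sup>2 / (16 * (s + L)\<^sup>2)) * (1 / (t - u) + 1 / (w - t)) \<le>
     (2 * s * t) * (1 / (y - l) + 1 / (r - y))"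
proof -
  have yl: "y - l = s * (w - t) * (w + t)" and ry: "r - y = s * (t - u) * (t + u)"
    using assms by (auto simp: algebra_simps power2_eq_square)
  have pos: "0 < w - t" "0 < w + t" "0 < t - u" "0 < t + u"
    using assms by auto
  define q where "q = (t - u) * (w - t) / ((t + u) * (w + t))"
  have *: "(2 * s * t) * (1 / (y - l) + 1 / (r - y)) = (1 + q) * (1 / (t - u) + 1 / (w - t))"
    unfolding yl ry q_def using pos assms(1) by (simp add: divide_simps) algebra
  have q: "q = (r - y) * (y - l) / (s\<^sup>2 * ((t + u) * (w + t))\<^sup>2)"
    unfolding yl ry q_def using pos assms(1) by (simp add: divide_simps power2_eq_square)
  have "s * w\<^sup>2 \<le> s + L"
    using assms by (simp add: algebra_simps)
  moreover have "(t + u) * (w + t) \<le> (2 * w) * (2 * w)"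
    using assms by (intro mult_mono) auto
  then have "s * ((t + u) * (w + t)) \<le> s * ((2 * w) * (2 * w))"
    using assms by (intro mult_left_mono) auto
  ultimately have "s * ((t + u) * (w + t)) \<le> 4 * (s + L)"
    by (simp add: power2_eq_square)
  then have "(s * ((t + u) * (w + t)))\<^sup>2 \<le> (4 * (s + L))\<^sup>2"
    using pos assms by (intro power_mono) auto
  also have "(4 * (s + L))\<^sup>2 = 16 * (s + L)\<^sup>2"
    unfolding power_mult_distrib by simp
  finally have d: "s\<^sup>2 * ((t + u) * (w + t))\<^sup>2 \<le> 16 * (s + L)\<^sup>2"
    unfolding power_mult_distrib .
  have "\<delta>\<^sup>2 \<le> (r - y) * (y - l)"
    unfolding power2_eq_square using assms by (intro mult_mono) auto
  then have "\<delta>\<^sup>2 / (16 * (s + L)\<^sup>2) \<le> q"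
    unfolding q using d pos assms by (intro frac_le) auto
  then show ?thesis
    unfolding * using pos by (intro mult_right_mono add_mono) auto
qed

text \<open>The gap of \<open>quad a x\<close> pulls back to two intervals without points of
  \<open>P\<close>. The gap of \<open>x\<close> contains the one on its side of 0, hence has smaller
  density than that interval, and the branch computation applies to the interval.\<close>

lemma gap_density_expansion:
  assumes a: "0 < a" and P: "closed P" "quad a ` P \<subseteq> P" "0 \<in> P"
    and x: "x \<notin> P" "p \<in> P" "p < x" "p' \<in> P" "x < p'"
    and y: "- L \<in> P" "- L < quad a x" "0 \<le> L"
    and \<delta>: "0 < \<delta>" "\<And>q. q \<in> P \<Longrightarrow> \<delta> \<le> \<bar>q - quad a x\<bar>"
  shows "(1 + \<delta>\<^sup>2 / (16 * (sqrt a + L)\<^sup>2)) * gap_density P x \<le>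
     (2 * sqrt a * \<bar>x\<bar>) * gap_density P (quad a x)"
proof -
  define s where "s = sqrt a"
  define y where "y = quad a x"
  define t where "t = \<bar>x\<bar>"
  define l where "l = gap_left P y"
  define r where "r = gap_right P y"
  have s: "0 < s"
    using a by (simp add: s_def)
  have yt: "y = s * (1 - t\<^sup>2)"
    by (simp add: y_def s_def t_def quad_def)
  have t: "0 < t"
    using x(1) P(3) by (auto simp: t_def)
  have yP: "y \<notin> P"
    using \<delta>(1) \<delta>(2)[of y] by (auto simp: y_def)
  have ls: "l \<in> P" "l < y" "- L \<le> l"
    using gap_left_props[OF P(1) yP y(1)] y by (auto simp: l_def y_def)
  have sP: "s \<in> P"
    using P(2,3) by (force simp: s_def quad_def)
  have "y < s"
    using s t by (simp add: yt)
  note rr = gap_right_props[OF P(1) yP sP \<open>y < s\<close>]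
  have rs: "r \<in> P" "y < r" "r \<le> s"
    using rr(1,2) rr(3)[OF sP \<open>y < s\<close>] by (auto simp: r_def)
  have noP: False if "q \<in> P" "l < q" "q < r" for q
  proof (cases "q < y")
    case True
    then show False
      using gap_left_props(3)[OF P(1) yP y(1) _ that(1)] y(2) that by (auto simp: l_def y_def)
  next
    case False
    then have "y < q"
      using that yP by (auto simp: less_le)
    then show False
      using rr(3)[OF that(1)] that by (auto simp: r_def)
  qed
  \<comment> \<open>The nonnegative preimages of the ends \<open>r\<close> and \<open>l\<close>;
    \<open>r \<le> s\<close>, that is \<open>s \<in> P\<close>, makes \<open>u\<close> real.\<close>
  define u where "u = sqrt (1 - r / s)"
  define w where "w = sqrt (1 - l / s)"
  have r1: "r / s \<le> 1"
    using rs s by simp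
  have l1: "l / s < 1"
    using ls \<open>y < s\<close> s by simp
  have u2: "u\<^sup>2 = 1 - r / s" and w2: "w\<^sup>2 = 1 - l / s" and u0: "0 \<le> u" and w0: "0 \<le> w"
    using r1 l1 by (auto simp: u_def w_def)
  have reqn: "r = s * (1 - u\<^sup>2)" and leqn: "l = s * (1 - w\<^sup>2)"
    using s by (auto simp: u2 w2)
  have "s * (1 - t\<^sup>2) < s * (1 - u\<^sup>2)"
    using rs(2) unfolding yt reqn .
  then have "u\<^sup>2 < t\<^sup>2"
    using s by simp
  then have ut: "u < t"
    using t by (simp add: power2_less_imp_less)
  have "s * (1 - w\<^sup>2) < s * (1 - t\<^sup>2)"
    using ls(2) unfolding yt leqn .
  then have "t\<^sup>2 < w\<^sup>2"
    using s by simp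
  then have tw: "t < w"
    using w0 by (simp add: power2_less_imp_less)
  \<comment> \<open>A point of \<open>P\<close> with modulus strictly between \<open>u\<close> and
    \<open>w\<close> would be mapped into \<open>(l, r)\<close>, against forward invariance.\<close>
  have gapW: "\<bar>q\<bar> \<le> u \<or> w \<le> \<bar>q\<bar>" if "q \<in> P" for q
  proof (rule ccontr)
    assume "\<not> ?thesis"
    then have q: "u < \<bar>q\<bar>" "\<bar>q\<bar> < w"
      by auto
    have "u\<^sup>2 < q\<^sup>2" "q\<^sup>2 < w\<^sup>2"
      using power_strict_mono[OF q(1) u0, of 2] power_strict_mono[OF q(2), of 2] by auto
    then have "l < quad a q" "quad a q < r"
      unfolding leqn reqn quad_def s_def[symmetric] using s by auto
    moreover have "quad a q \<in> P"
      using P(2) that by auto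
    ultimately show False
      using noP by blast
  qed
  have X: "gap_left P x \<in> P" "gap_left P x < x" "gap_right P x \<in> P" "x < gap_right P x"
    using gap_left_props[OF P(1) x(1,2,3)] gap_right_props[OF P(1) x(1,4,5)] by auto
  have "gap_density P x \<le> 1 / (t - u) + 1 / (w - t)"
  proof (cases "0 < x")
    case True
    then have tx: "t = x"
      by (simp add: t_def)
    have "gap_left P x \<le> u" "w \<le> gap_right P x"
      using gapW[OF X(1)] gapW[OF X(3)] X(2,4) ut tw tx u0 by auto
    then have "1 / (x - gap_left P x) \<le> 1 / (t - u)" "1 / (gap_right P x - x) \<le> 1 / (w - t)"
      using ut tw X unfolding tx by (auto intro!: divide_left_mono mult_pos_pos)
    then show ?thesis
      unfolding gap_density_def by simp
  next
    case False
    then have tx: "x = - t"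
      by (simp add: t_def)
    have "gap_left P x \<le> - w" "- u \<le> gap_right P x"
      using gapW[OF X(1)] gapW[OF X(3)] X(2,4) ut tw tx u0 by auto
    then have "1 / (x - gap_left P x) \<le> 1 / (w - t)" "1 / (gap_right P x - x) \<le> 1 / (t - u)"
      using ut tw X unfolding tx by (auto intro!: divide_left_mono mult_pos_pos)
    then show ?thesis
      unfolding gap_density_def by simp
  qed
  then have "(1 + \<delta>\<^sup>2 / (16 * (s + L)\<^sup>2)) * gap_density P x \<le>
      (1 + \<delta>\<^sup>2 / (16 * (s + L)\<^sup>2)) * (1 / (t - u) + 1 / (w - t))"
    by (intro mult_left_mono) auto
  also have "\<dots> \<le> (2 * s * t) * (1 / (y - l) + 1 / (r - y))"
  proof (rule gap_density_branch_algebra[OF s u0 ut tw reqn leqn yt \<delta>(1)])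
    show "\<delta> \<le> y - l"
      using \<delta>(2)[OF ls(1)] ls(2) by (simp add: y_def)
    show "\<delta> \<le> r - y"
      using \<delta>(2)[OF rs(1)] rs(2) by (simp add: y_def)
  qed (use ls y in auto)
  also have "1 / (y - l) + 1 / (r - y) = gap_density P y"
    by (simp add: gap_density_def l_def r_def)
  finally show ?thesis
    by (simp add: s_def t_def y_def)
qed

text \<open>Compactness of \<open>X\<close> gives a positive distance \<open>\<delta>\<close> to
  \<open>P\<close>, which makes the expansion factor uniform. The points \<open>- L\<close> and
  \<open>p\<close> of \<open>P\<close> enclose \<open>X\<close>, so all gaps met are
  bounded.\<close>

lemma expanding_weight:
  assumes a: "0 < a" and P: "closed P" "quad a ` P \<subseteq> P" "0 \<in> P"
    and X: "compact X" "X \<inter> P = {}" "X \<noteq> {}"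
    and b: "- L \<in> P" "\<And>x. x \<in> X \<Longrightarrow> - L < x" "0 \<le> L" "p \<in> P" "\<And>x. x \<in> X \<Longrightarrow> x < p"
  obtains \<rho> m M \<theta> where "0 < m" "0 < \<theta>" "\<theta> < 1" "\<And>x. x \<in> X \<Longrightarrow> m \<le> \<rho> x"
    "\<And>x. x \<in> X \<Longrightarrow> \<rho> x \<le> M"
    "\<And>x. x \<in> X \<Longrightarrow> quad a x \<in> X \<Longrightarrow> \<rho> x \<le> \<theta> * (2 * sqrt a * \<bar>x\<bar>) * \<rho> (quad a x)"
proof -
  define \<delta> where "\<delta> = setdist X P"
  have \<delta>: "0 < \<delta>"
    using X P setdist_gt_0_compact_closed[of X P] by (auto simp: \<delta>_def)
  have \<delta>': "\<delta> \<le> \<bar>q - x\<bar>" if "q \<in> P" "x \<in> X" for q x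
    using setdist_le_dist[OF that(2,1)] by (simp add: \<delta>_def dist_real_def)
  define lam where "lam = 1 + \<delta>\<^sup>2 / (16 * (sqrt a + L)\<^sup>2)"
  have lam: "1 < lam"
  proof -
    have "0 < sqrt a + L"
      using a b(3) by (simp add: add_pos_nonneg)
    then show ?thesis
      using \<delta> by (simp add: lam_def)
  qed
  have G: "gap_left P x \<in> P" "gap_left P x < x" "- L \<le> gap_left P x"
    "gap_right P x \<in> P" "x < gap_right P x" "gap_right P x \<le> p" if "x \<in> X" for x
  proof -
    have "x \<notin> P"
      using X(2) that by auto
    note * = gap_left_props[OF P(1) this b(1) b(2)[OF that]]
      gap_right_props[OF P(1) this b(4) b(5)[OF that]]
    show "gap_left P x \<in> P" "gap_left P x < x" "- L \<le> gap_left P x"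
      "gap_right P x \<in> P" "x < gap_right P x" "gap_right P x \<le> p"
      using *(1,2,4,5) *(3)[OF b(1) b(2)[OF that]] *(6)[OF b(4) b(5)[OF that]] by auto
  qed
  have Lp: "0 < p + L"
    using X(3) b(2,5) by force
  \<comment> \<open>A gap has length at most \<open>p + L\<close>, which bounds the density below;
    its ends are at distance at least \<open>\<delta>\<close> from \<open>x\<close>, which bounds it
    above by \<open>2 / \<delta>\<close>.\<close>
  show ?thesis
  proof (rule that[of "1 / (p + L)" "1 / lam" "gap_density P" "2 / \<delta>"])
    fix x assume x: "x \<in> X"
    note G = G[OF x]
    have pos: "0 < x - gap_left P x" "0 < gap_right P x - x"
      using G by auto
    have "1 / (p + L) \<le> 1 / (gap_right P x - x)"
      using G pos b(2)[OF x] by (intro divide_left_mono) (auto intro!: mult_pos_pos)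
    also have "\<dots> \<le> gap_density P x"
      unfolding gap_density_def using pos by simp
    finally show "1 / (p + L) \<le> gap_density P x" .
    have "1 / (x - gap_left P x) \<le> 1 / \<delta>" "1 / (gap_right P x - x) \<le> 1 / \<delta>"
      using \<delta> \<delta>'[OF G(1) x] \<delta>'[OF G(4) x] pos by (auto intro!: divide_left_mono mult_pos_pos)
    then show "gap_density P x \<le> 2 / \<delta>"
      unfolding gap_density_def by simp
    assume y: "quad a x \<in> X"
    have "lam * gap_density P x \<le> (2 * sqrt a * \<bar>x\<bar>) * gap_density P (quad a x)"
      unfolding lam_def
      by (rule gap_density_expansion[where p = "- L" and p' = p])
        (use a P x y X(2) b \<delta> \<delta>'[OF _ y] in auto)
    then show "gap_density P x \<le> 1 / lam * (2 * sqrt a * \<bar>x\<bar>) * gap_density P (quad a x)"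
      using lam by (simp add: field_simps)
  qed (use lam Lp in auto)
qed

subsection \<open>Escaping orbits, basins and the critical orbit\<close>

text \<open>The radius is chosen so that \<open>sqrt a * (\<bar>x\<bar> - 1) \<ge> 2\<close>; the
  remaining factor of \<open>x\<^sup>2 - 1\<close> is \<open>\<bar>x\<bar> + 1\<close>.\<close>

lemma quad_escape:
  assumes a: "0 < a" and x: "1 + 2 / sqrt a \<le> \<bar>x\<bar>"
  shows "2 * \<bar>x\<bar> \<le> \<bar>quad a x\<bar>"
proof -
  have s: "0 < sqrt a"
    using a by simp
  have x1: "1 \<le> \<bar>x\<bar>"
    using x s by (smt (verit) divide_nonneg_pos)
  have "2 \<le> sqrt a * (\<bar>x\<bar> - 1)"
    using x s by (simp add: field_simps)
  then have "2 * (\<bar>x\<bar> + 1) \<le> sqrt a * (\<bar>x\<bar> - 1) * (\<bar>x\<bar> + 1)"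
    by (intro mult_right_mono) auto
  also have "\<dots> = sqrt a * (x\<^sup>2 - 1)"
    by (simp add: algebra_simps power2_eq_square)
  also have "\<dots> \<le> \<bar>quad a x\<bar>"
    unfolding quad_def by (simp add: algebra_simps)
  finally show ?thesis
    by simp
qed

lemma quad_escape_funpow:
  assumes a: "0 < a" and x: "1 + 2 / sqrt a \<le> \<bar>x\<bar>"
  shows "2 ^ n * \<bar>x\<bar> \<le> \<bar>(quad a ^^ n) x\<bar>"
proof (induction n)
  case (Suc n)
  have "\<bar>x\<bar> \<le> 2 ^ n * \<bar>x\<bar>"
    by (simp add: mult_le_cancel_right1)
  then have "1 + 2 / sqrt a \<le> \<bar>(quad a ^^ n) x\<bar>"
    using x Suc by linarith
  from quad_escape[OF a this] Suc show ?case
    by simp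
qed simp

lemma quad_escape_at_infinity:
  assumes a: "0 < a" and x: "1 + 2 / sqrt a \<le> \<bar>x\<bar>"
  shows "filterlim (\<lambda>n. (quad a ^^ n) x) at_infinity sequentially"
proof (rule filterlim_norm_at_top_imp_at_infinity)
  have x1: "1 \<le> \<bar>x\<bar>"
    using a x by (smt (verit) divide_pos_pos real_sqrt_gt_zero)
  show "filterlim (\<lambda>n. norm ((quad a ^^ n) x)) at_top sequentially"
  proof (rule filterlim_at_top_mono[OF filterlim_real_sequentially], intro always_eventually allI)
    fix n
    have "real n \<le> 2 ^ n * 1"
      using of_nat_less_two_power[of n, where 'a=real] by simp
    also have "\<dots> \<le> 2 ^ n * \<bar>x\<bar>"
      using x1 by (intro mult_left_mono) auto
    also have "\<dots> \<le> norm ((quad a ^^ n) x)"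
      using quad_escape_funpow[OF a x] by simp
    finally show "real n \<le> norm ((quad a ^^ n) x)" .
  qed
qed

lemma at_infinity_imp_unbounded_range:
  fixes u :: "nat \<Rightarrow> 'a::real_normed_vector"
  assumes "filterlim u at_infinity sequentially"
  shows "\<not> bounded (range u)"
proof
  assume "bounded (range u)"
  then obtain B where B: "\<And>n. norm (u n) \<le> B"
    by (auto simp: bounded_iff)
  then have "0 \<le> B"
    using norm_ge_zero order_trans by blast
  then have "\<forall>\<^sub>F n in sequentially. B + 1 \<le> norm (u n)"
    using assms by (auto simp: filterlim_at_infinity[of 0])
  then obtain n where "B + 1 \<le> norm (u n)"
    by (auto simp: eventually_sequentially)
  with B[of n] show False
    by simp
qed

text \<open>Only finitely many terms meet a given ball, so the range has no limit points. Thus an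
  escaping orbit needs no closure.\<close>

lemma at_infinity_imp_closed_range:
  fixes u :: "nat \<Rightarrow> 'a::real_normed_vector"
  assumes "filterlim u at_infinity sequentially"
  shows "closed (range u)"
  unfolding closed_limpt
proof (intro allI impI)
  fix z assume "z islimpt range u"
  then have inf: "infinite (range u \<inter> ball z 1)"
    by (simp add: islimpt_eq_infinite_ball)
  have "\<forall>\<^sub>F n in sequentially. norm z + 1 \<le> norm (u n)"
    using assms by (auto simp: filterlim_at_infinity[of 0] add_nonneg_pos)
  then obtain N where N: "\<And>n. N \<le> n \<Longrightarrow> norm z + 1 \<le> norm (u n)"
    by (auto simp: eventually_sequentially)
  have "range u \<inter> ball z 1 \<subseteq> u ` {..<N}"
  proof
    fix w assume "w \<in> range u \<inter> ball z 1"
    then obtain n where n: "w = u n" "dist z (u n) < 1"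
      by auto
    have "norm (u n) < norm z + 1"
      using n(2) norm_triangle_ineq2[of "u n" z] by (simp add: dist_norm norm_minus_commute)
    with N[of n] have "n < N"
      by force
    with n show "w \<in> u ` {..<N}"
      by auto
  qed
  with inf show "z \<in> range u"
    using finite_subset by blast
qed

lemma bounded_orbit_less:
  assumes "0 < a" "bounded (forward_orbit (quad a) x)"
  shows "\<bar>x\<bar> < 1 + 2 / sqrt a"
  using at_infinity_imp_unbounded_range[OF quad_escape_at_infinity[OF assms(1), of x]] assms(2)
  by (force simp: forward_orbit_def)

lemma forward_orbit_self: "x \<in> forward_orbit f x"
  unfolding forward_orbit_def by (rule range_eqI[of _ _ 0]) simp

lemma forward_orbit_image: "f ` forward_orbit f x \<subseteq> forward_orbit f x"
  unfolding forward_orbit_def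
proof (clarsimp)
  fix n show "f ((f ^^ n) x) \<in> range (\<lambda>n. (f ^^ n) x)"
    by (rule range_eqI[of _ _ "Suc n"]) simp
qed

lemma forward_orbit_step: "forward_orbit f x = insert x (forward_orbit f (f x))"
proof -
  have "range (\<lambda>n. (f ^^ n) x) = insert ((f ^^ 0) x) (range (\<lambda>n. (f ^^ Suc n) x))"
    by (subst UNIV_nat_eq) (simp only: image_insert image_image)
  then show ?thesis
    by (simp add: forward_orbit_def funpow_swap1)
qed

lemma forward_orbit_funpow: "y \<in> forward_orbit f x \<Longrightarrow> forward_orbit f y \<subseteq> forward_orbit f x"
  unfolding forward_orbit_def
proof clarsimp
  fix m n show "(f ^^ m) ((f ^^ n) x) \<in> range (\<lambda>n. (f ^^ n) x)"
    by (rule range_eqI[of _ _ "m + n"]) (simp add: funpow_add)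
qed

section \<open>Basins of attracting periodic orbits\<close>

lemma basin_funpow: "(f ^^ k) x \<in> basin f S \<longleftrightarrow> x \<in> basin f S"
proof -
  have "(\<lambda>n. infdist ((f ^^ n) ((f ^^ k) x)) S) = (\<lambda>n. infdist ((f ^^ (n + k)) x) S)"
    by (simp add: funpow_add)
  then show ?thesis
    unfolding basin_def mem_Collect_eq
    using LIMSEQ_offset[of "\<lambda>n. infdist ((f ^^ n) x) S" k]
      LIMSEQ_ignore_initial_segment[of "\<lambda>n. infdist ((f ^^ n) x) S" 0 k] by metis
qed

lemma basin_step: "f x \<in> basin f S \<longleftrightarrow> x \<in> basin f S"
  using basin_funpow[of 1 f] by simp

lemma continuous_on_funpow:
  fixes f :: "'a::topological_space \<Rightarrow> 'a"
  assumes "continuous_on UNIV f"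
  shows "continuous_on UNIV (f ^^ n)"
proof (induction n)
  case (Suc n)
  then show ?case
    unfolding funpow.simps using assms by (intro continuous_on_compose continuous_on_subset[OF assms]) auto
qed (simp add: id_def)

lemma periodic_forward_orbit:
  assumes "0 < n" "(f ^^ n) p = p"
  shows "forward_orbit f p = (\<lambda>j. (f ^^ j) p) ` {..<n}"
  unfolding forward_orbit_def
proof (intro equalityI subsetI; clarify)
  fix m show "(f ^^ m) p \<in> (\<lambda>j. (f ^^ j) p) ` {..<n}"
    using assms by (intro image_eqI[of _ _ "m mod n"]) (auto simp: funpow_mod_eq)
qed auto

text \<open>Near \<open>p\<close> the period map contracts towards \<open>p\<close> by a factor
  \<open>q\<close> between \<open>\<bar>D\<bar>\<close> and 1. Times that are not multiples of the
  period are controlled by continuity of the finitely many iterates within one period.\<close>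

lemma attracting_local_basin:
  fixes f :: "real \<Rightarrow> real"
  assumes cont: "continuous_on UNIV f" and n: "0 < n" "(f ^^ n) p = p"
    and D: "(f ^^ n has_real_derivative D) (at p)" "\<bar>D\<bar> < 1"
  obtains e where "0 < e" "ball p e \<subseteq> basin f (forward_orbit f p)"
proof -
  define g where "g = f ^^ n"
  have gp: "g p = p"
    using n by (simp add: g_def)
  obtain q where q: "\<bar>D\<bar> < q" "q < 1"
    using D(2) dense by blast
  then have q0: "0 < q"
    by linarith
  have "((\<lambda>x. \<bar>(g x - g p) / (x - p)\<bar>) \<longlongrightarrow> \<bar>D\<bar>) (at p)"
    using D(1) unfolding g_def[symmetric] has_field_derivative_iff by (rule tendsto_rabs)
  then have "\<forall>\<^sub>F x in at p. \<bar>(g x - g p) / (x - p)\<bar> < q"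
    using q(1) by (rule order_tendstoD)
  then obtain e where e: "0 < e"
    "\<And>x. x \<noteq> p \<Longrightarrow> dist x p < e \<Longrightarrow> \<bar>(g x - g p) / (x - p)\<bar> < q"
    unfolding eventually_at by auto
  have contr: "\<bar>g x - p\<bar> \<le> q * \<bar>x - p\<bar>" if "\<bar>x - p\<bar> < e" for x
  proof (cases "x = p")
    case False
    then have "\<bar>g x - p\<bar> / \<bar>x - p\<bar> < q"
      using e(2)[of x] that gp by (simp add: dist_real_def abs_divide)
    then show ?thesis
      using False by (simp add: divide_simps split: if_splits)
  qed (simp add: gp)
  have iter: "\<bar>(g ^^ k) x - p\<bar> \<le> q ^ k * \<bar>x - p\<bar>" if x: "\<bar>x - p\<bar> < e" for x k
  proof (induction k)
    case (Suc k)
    have "q ^ k * \<bar>x - p\<bar> \<le> 1 * \<bar>x - p\<bar>"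
      using q q0 by (intro mult_right_mono power_le_one) auto
    then have "\<bar>(g ^^ k) x - p\<bar> < e"
      using Suc x by simp
    from contr[OF this] have "\<bar>(g ^^ Suc k) x - p\<bar> \<le> q * \<bar>(g ^^ k) x - p\<bar>"
      by simp
    also have "\<dots> \<le> q * (q ^ k * \<bar>x - p\<bar>)"
      using Suc q0 by (intro mult_left_mono) auto
    finally show ?case
      by simp
  qed simp
  \<comment> \<open>The total deviation over one period: continuous, zero at \<open>p\<close>, and
    an upper bound for the distance to the orbit at each phase.\<close>
  define h where "h z = (\<Sum>j<n. \<bar>(f ^^ j) z - (f ^^ j) p\<bar>)" for z
  have "continuous_on UNIV h"
    unfolding h_def by (intro continuous_intros continuous_on_funpow cont)
  then have h: "(h \<longlongrightarrow> h p) (at p)"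
    by (simp add: continuous_on_def)
  have hp: "h p = 0"
    by (simp add: h_def)
  have "ball p e \<subseteq> basin f (forward_orbit f p)"
  proof
    fix x assume "x \<in> ball p e"
    then have x: "\<bar>x - p\<bar> < e"
      by (simp add: dist_real_def abs_minus_commute)
    have "(\<lambda>k. (g ^^ k) x - p) \<longlonglongrightarrow> 0"
    proof (rule tendsto_rabs_zero_cancel[OF tendsto_sandwich[OF _ _ tendsto_const]])
      show "\<forall>\<^sub>F k in sequentially. 0 \<le> \<bar>(g ^^ k) x - p\<bar>"
        "\<forall>\<^sub>F k in sequentially. \<bar>(g ^^ k) x - p\<bar> \<le> q ^ k * \<bar>x - p\<bar>"
        using iter[OF x] by auto
      show "(\<lambda>k. q ^ k * \<bar>x - p\<bar>) \<longlonglongrightarrow> 0"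
        using q q0 by (intro tendsto_mult_left_zero LIMSEQ_realpow_zero) auto
    qed
    then have lim: "(\<lambda>k. (g ^^ k) x) \<longlonglongrightarrow> p"
      by (simp add: LIM_zero_iff)
    have "isCont h p"
      using h by (simp add: isCont_def)
    from isCont_tendsto_compose[OF this lim] have "(\<lambda>k. h ((g ^^ k) x)) \<longlonglongrightarrow> 0"
      by (simp add: hp)
    moreover have "filterlim (\<lambda>m. m div n) at_top sequentially"
      unfolding filterlim_at_top eventually_sequentially
    proof
      fix Z show "\<exists>N. \<forall>m\<ge>N. Z \<le> m div n"
        using n(1) div_le_mono[of "Z * n" _ n] by (intro exI[of _ "Z * n"]) auto
    qed
    ultimately have lim2: "(\<lambda>m. h ((g ^^ (m div n)) x)) \<longlonglongrightarrow> 0"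
      by (rule filterlim_compose)
    have bd: "infdist ((f ^^ m) x) (forward_orbit f p) \<le> h ((g ^^ (m div n)) x)" for m
    proof -
      define z where "z = (g ^^ (m div n)) x"
      have "(f ^^ m) x = (f ^^ (m mod n + n * (m div n))) x"
        by simp
      also have "\<dots> = (f ^^ (m mod n)) z"
        unfolding funpow_add z_def g_def funpow_mult by simp
      finally have "infdist ((f ^^ m) x) (forward_orbit f p) \<le> \<bar>(f ^^ (m mod n)) z - (f ^^ (m mod n)) p\<bar>"
        by (metis dist_real_def infdist_le forward_orbit_def rangeI)
      also have "\<dots> \<le> h z"
        unfolding h_def using n(1) by (intro member_le_sum) auto
      finally show ?thesis
        by (simp add: z_def)
    qed
    have "(\<lambda>m. infdist ((f ^^ m) x) (forward_orbit f p)) \<longlonglongrightarrow> 0"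
      by (rule tendsto_sandwich[OF _ _ tendsto_const lim2]) (use bd in \<open>auto simp: infdist_nonneg\<close>)
    then show "x \<in> basin f (forward_orbit f p)"
      by (simp add: basin_def)
  qed
  with e(1) that show ?thesis
    by blast
qed

text \<open>The basin equals the union \<open>U\<close> of all preimages of a small ball around
  \<open>p\<close>. This set is open and contains the orbit, hence a neighbourhood of it, and every
  orbit in the basin enters that neighbourhood.\<close>

lemma attracting_basin:
  fixes f :: "real \<Rightarrow> real"
  assumes cont: "continuous_on UNIV f" and diff: "\<And>n x. f ^^ n differentiable at x"
    and p: "attracting_periodic_point f p"
  defines "Orb \<equiv> forward_orbit f p"
  shows "finite Orb" "open (basin f Orb)"
    "\<exists>e>0. {z. infdist z Orb \<le> e} \<subseteq> basin f Orb"
proof -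
  obtain n where n: "0 < n" "(f ^^ n) p = p" and d: "\<bar>deriv (f ^^ n) p\<bar> < 1"
    using p by (auto simp: attracting_periodic_point_def has_least_period_def)
  have "(f ^^ n has_real_derivative deriv (f ^^ n) p) (at p)"
    using diff by (metis DERIV_deriv_iff_real_differentiable)
  from attracting_local_basin[OF cont n this d] obtain e where
    e: "0 < e" "ball p e \<subseteq> basin f Orb"
    unfolding Orb_def by blast
  show fin: "finite Orb"
    unfolding Orb_def periodic_forward_orbit[OF n] by simp
  define U where "U = (\<Union>k. (f ^^ k) -` ball p e)"
  have oU: "open U"
    unfolding U_def by (intro open_UN ballI open_vimage continuous_on_funpow cont) auto
  have UB: "U \<subseteq> basin f Orb"
    using e(2) basin_funpow unfolding U_def by fast
  have "Orb \<subseteq> U"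
  proof
    fix y assume "y \<in> Orb"
    then obtain j where j: "y = (f ^^ j) p"
      by (auto simp: Orb_def forward_orbit_def)
    \<comment> \<open>Since \<open>n \<ge> 1\<close> the natural subtraction is exact:
      \<open>n * j - j\<close> further steps complete \<open>j\<close> full periods, so
      \<open>y\<close> reaches \<open>p\<close>.\<close>
    have "(f ^^ (n * j - j)) y = (f ^^ (n * j - j + j)) p"
      unfolding j funpow_add by simp
    also have "\<dots> = (f ^^ (j * n)) p"
      using n(1) by (simp add: mult.commute)
    also have "\<dots> = p"
      using funpow_mod_eq[OF n(2), of "j * n"] by simp
    finally show "y \<in> U"
      using e(1) by (auto simp: U_def intro!: exI[of _ "n * j - j"])
  qed
  moreover have cO: "compact Orb"
    using fin by (rule finite_imp_compact)
  ultimately obtain d where d: "0 < d" "(\<Union>x\<in>Orb. ball x d) \<subseteq> U"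
    using compact_subset_open_imp_ball_epsilon_subset oU by metis
  have ne: "Orb \<noteq> {}"
    unfolding Orb_def using forward_orbit_self[of p f] by auto
  have near: "z \<in> U" if "infdist z Orb < d" for z
  proof -
    obtain x where "x \<in> Orb" "infdist z Orb = dist z x"
      using infdist_attains_inf[OF compact_imp_closed[OF cO] ne] by metis
    with that d(2) show ?thesis
      by (force simp: dist_commute)
  qed
  have "basin f Orb \<subseteq> U"
  proof
    fix x assume "x \<in> basin f Orb"
    then have "\<forall>\<^sub>F m in sequentially. infdist ((f ^^ m) x) Orb < d"
      using d(1) by (auto simp: basin_def intro: order_tendstoD)
    then obtain m where "(f ^^ m) x \<in> U"
      using near by (auto simp: eventually_sequentially)
    then obtain k where "(f ^^ (k + m)) x \<in> ball p e"
      by (auto simp: U_def funpow_add)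
    then show "x \<in> U"
      unfolding U_def by blast
  qed
  with UB have "basin f Orb = U"
    by blast
  with oU show "open (basin f Orb)"
    by simp
  show "\<exists>e>0. {z. infdist z Orb \<le> e} \<subseteq> basin f Orb"
    using d(1) near UB by (intro exI[of _ "d / 2"]) force
qed

text \<open>All but finitely many points of the orbit lie in a closed neighbourhood of
  \<open>S\<close> inside the basin, so taking the closure adds nothing outside it.\<close>

lemma closure_orbit_subset_basin:
  fixes f :: "'a::metric_space \<Rightarrow> 'a"
  assumes e: "0 < e" "{z. infdist z S \<le> e} \<subseteq> basin f S" and x: "x \<in> basin f S"
  shows "closure (forward_orbit f x) \<subseteq> basin f S"
proof -
  have "\<forall>\<^sub>F m in sequentially. infdist ((f ^^ m) x) S < e"
    using e(1) x by (auto simp: basin_def intro: order_tendstoD)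
  then obtain N where N: "\<And>m. N \<le> m \<Longrightarrow> infdist ((f ^^ m) x) S < e"
    by (auto simp: eventually_sequentially)
  let ?C = "(\<lambda>n. (f ^^ n) x) ` {..<N} \<union> {z. infdist z S \<le> e}"
  have "forward_orbit f x \<subseteq> ?C"
  proof
    fix y assume "y \<in> forward_orbit f x"
    then obtain n where "y = (f ^^ n) x"
      by (auto simp: forward_orbit_def)
    then show "y \<in> ?C"
      using N[of n] by (cases "n < N") auto
  qed
  moreover have cl: "closed {z. infdist z S \<le> e}"
    by (intro closed_Collect_le continuous_intros)
  have "closed ?C"
    by (rule closed_Un[OF finite_imp_closed cl]) simp
  ultimately have "closure (forward_orbit f x) \<subseteq> ?C"
    by (rule closure_minimal)
  also have "\<dots> \<subseteq> basin f S"
    using e(2) x basin_funpow by fast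
  finally show ?thesis .
qed

section \<open>Uniform expansion away from the critical orbit\<close>

lemma differentiable_quad_funpow: "quad a ^^ n differentiable at x"
proof (induction n)
  case (Suc n)
  have "quad a differentiable at y" for y
    using has_derivative_quad real_differentiable_def by blast
  with Suc show ?case
    unfolding funpow.simps by (intro differentiable_chain_at)
qed (simp add: id_def)

text \<open>Bounded orbits start inside radius \<open>R\<close>, while the orbit of \<open>R\<close>
  stays at modulus at least \<open>R\<close>; so \<open>X\<close> misses all of \<open>P\<close>.
  The points \<open>R\<close> and \<open>quad a R \<le> - 2 * R\<close> of \<open>P\<close> enclose
  \<open>X\<close>. The set \<open>X\<close> is left general because it serves for the repeller and,
  in a proof by contradiction, for an attracting periodic orbit.\<close>

lemma quad_expanding:
  assumes a: "0 < a" and X: "compact X" "X \<inter> closure (forward_orbit (quad a) 0) = {}"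
    and bd: "\<And>x. x \<in> X \<Longrightarrow> bounded (forward_orbit (quad a) x)"
  obtains \<rho> m M \<theta> where "0 < m" "0 < \<theta>" "\<theta> < 1" "\<And>x. x \<in> X \<Longrightarrow> m \<le> \<rho> x"
    "\<And>x. x \<in> X \<Longrightarrow> \<rho> x \<le> M"
    "\<And>x. x \<in> X \<Longrightarrow> quad a x \<in> X \<Longrightarrow> \<rho> x \<le> \<theta> * (2 * sqrt a * \<bar>x\<bar>) * \<rho> (quad a x)"
proof (cases "X = {}")
  case True
  show ?thesis
    by (rule that[of 1 "1/2" "\<lambda>_. 1" 1]) (use True in auto)
next
  case False
  define R where "R = 1 + 2 / sqrt a"
  have R: "1 < R"
    using a by (simp add: R_def)
  have R_le: "R \<le> \<bar>R\<bar>"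
    by simp
  let ?f = "quad a"
  define P where "P = closure (forward_orbit ?f 0) \<union> forward_orbit ?f R"
  have "closed (forward_orbit ?f R)"
    unfolding forward_orbit_def using quad_escape_at_infinity[OF a R_le[unfolded R_def]]
    by (intro at_infinity_imp_closed_range) (simp add: R_def)
  then have P1: "closed P"
    by (simp add: P_def closed_Un)
  have "?f ` closure (forward_orbit ?f 0) \<subseteq> closure (forward_orbit ?f 0)"
    using forward_orbit_image[of ?f 0] closure_subset
    by (intro image_closure_subset continuous_quad) auto
  then have P2: "?f ` P \<subseteq> P"
    using forward_orbit_image[of ?f R] unfolding P_def by blast
  have P3: "0 \<in> P"
    using forward_orbit_self closure_subset unfolding P_def by fast
  have X1: "\<bar>x\<bar> < R" if "x \<in> X" for x
    using bounded_orbit_less[OF a bd[OF that]] by (simp add: R_def)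
  have "R \<le> \<bar>y\<bar>" if "y \<in> forward_orbit ?f R" for y
  proof -
    obtain n where n: "y = (?f ^^ n) R"
      using \<open>y \<in> forward_orbit ?f R\<close> by (auto simp: forward_orbit_def)
    have "1 * R \<le> 2 ^ n * \<bar>R\<bar>"
      using R by (intro mult_mono) auto
    with quad_escape_funpow[OF a R_le[unfolded R_def], of n] n show ?thesis
      by (simp add: R_def)
  qed
  with X1 have "X \<inter> forward_orbit ?f R = {}"
    by force
  with X(2) have XP: "X \<inter> P = {}"
    by (auto simp: P_def)
  have fR: "?f R < 0"
    using a R by (simp add: quad_def mult_pos_neg)
  with quad_escape[OF a R_le[unfolded R_def]] have fR': "2 * R \<le> - ?f R"
    using R by (simp add: R_def)
  \<comment> \<open>The double negation matches the form \<open>- L \<in> P\<close> with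
    \<open>L = - ?f R\<close>.\<close>
  have lower: "- (- ?f R) \<in> P" and upper: "R \<in> P"
    using forward_orbit_self[of R ?f] forward_orbit_image[of ?f R] by (auto simp: P_def)
  have b: "- (- ?f R) < x" "x < R" if "x \<in> X" for x
    using X1[OF that] fR' R by auto
  have "0 \<le> - ?f R"
    using fR by simp
  show ?thesis
    by (rule expanding_weight[OF a P1 P2 P3 X(1) XP False lower b(1) \<open>0 \<le> - ?f R\<close> upper b(2)])
      (assumption | fact that)+
qed

text \<open>By the chain rule the one-step inequalities multiply along the orbit, and the
  intermediate weights telescope. At a periodic point this bounds the multiplier from below.\<close>

lemma quad_funpow_derivative:
  assumes "\<And>x. x \<in> X \<Longrightarrow> quad a x \<in> X"
    and "\<And>x. x \<in> X \<Longrightarrow> \<rho> x \<le> \<theta> * (2 * sqrt a * \<bar>x\<bar>) * \<rho> (quad a x)"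
    and "0 < \<theta>" "0 \<le> a" "x \<in> X"
  shows "(quad a ^^ k) x \<in> X \<and>
    (\<exists>D. (quad a ^^ k has_real_derivative D) (at x) \<and> \<rho> x \<le> \<theta> ^ k * \<bar>D\<bar> * \<rho> ((quad a ^^ k) x))"
proof (induction k)
  case 0
  show ?case
    using assms by (auto simp: id_def intro!: exI[of _ 1] derivative_eq_intros)
next
  case (Suc k)
  define y where "y = (quad a ^^ k) x"
  obtain D where y: "y \<in> X" and D: "(quad a ^^ k has_real_derivative D) (at x)"
    and le: "\<rho> x \<le> \<theta> ^ k * \<bar>D\<bar> * \<rho> y"
    using Suc by (auto simp: y_def)
  have "(quad a ^^ Suc k has_real_derivative (- 2 * sqrt a * y) * D) (at x)"
    unfolding funpow.simps y_def by (rule DERIV_chain[OF has_derivative_quad D])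
  moreover have "\<rho> x \<le> \<theta> ^ Suc k * \<bar>(- 2 * sqrt a * y) * D\<bar> * \<rho> (quad a y)"
  proof -
    have "\<theta> ^ k * \<bar>D\<bar> * \<rho> y \<le> \<theta> ^ k * \<bar>D\<bar> * (\<theta> * (2 * sqrt a * \<bar>y\<bar>) * \<rho> (quad a y))"
      using assms(2)[OF y] assms(3) by (intro mult_left_mono) auto
    with le show ?thesis
      using \<open>0 \<le> a\<close> by (simp add: abs_mult ac_simps)
  qed
  moreover have "(quad a ^^ Suc k) x = quad a y"
    by (simp add: y_def)
  ultimately show ?case
    using assms(1)[OF y] by metis
qed

text \<open>This is Singer's theorem for the quadratic family: if the closure of the critical orbit
missed the periodic orbit, the gap density would make the multiplier exceed 1 in modulus.\<close>
lemma critical_point_in_attracting_basin: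
  assumes a: "0 < a" and p: "attracting_periodic_point (quad a) p"
  shows "0 \<in> basin (quad a) (forward_orbit (quad a) p)"
proof (rule ccontr)
  let ?f = "quad a"
  define Orb where "Orb = forward_orbit ?f p"
  assume "\<not> ?thesis"
  then have z: "0 \<notin> basin ?f Orb"
    by (simp add: Orb_def)
  note B = attracting_basin[OF continuous_quad differentiable_quad_funpow p, folded Orb_def]
  have sub: "Orb \<subseteq> basin ?f Orb"
    using B(3) by (auto simp: subset_iff)
  \<comment> \<open>The basin is open and a point lies in it as soon as some iterate does, so its
    complement is closed and contains the critical orbit.\<close>
  have "closure (forward_orbit ?f 0) \<subseteq> - basin ?f Orb"
    using z basin_funpow[of _ ?f 0 Orb] B(2)
    by (intro closure_minimal) (auto simp: forward_orbit_def closed_def)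
  then have disj: "Orb \<inter> closure (forward_orbit ?f 0) = {}"
    using sub by blast
  have bd: "bounded (forward_orbit ?f x)" if "x \<in> Orb" for x
    using forward_orbit_funpow[of x ?f p] that B(1)
    by (metis Orb_def bounded_subset finite_imp_bounded)
  obtain n where n: "0 < n" "(?f ^^ n) p = p" and d: "\<bar>deriv (?f ^^ n) p\<bar> < 1"
    using p by (auto simp: attracting_periodic_point_def has_least_period_def)
  have pO: "p \<in> Orb" and fO: "\<And>x. x \<in> Orb \<Longrightarrow> ?f x \<in> Orb"
    using forward_orbit_self forward_orbit_image by (fastforce simp: Orb_def)+
  obtain \<rho> m M \<theta> where w: "0 < m" "0 < \<theta>" "\<theta> < 1" "\<And>x. x \<in> Orb \<Longrightarrow> m \<le> \<rho> x"
    "\<And>x. x \<in> Orb \<Longrightarrow> ?f x \<in> Orb \<Longrightarrow> \<rho> x \<le> \<theta> * (2 * sqrt a * \<bar>x\<bar>) * \<rho> (?f x)"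
    by (rule quad_expanding[OF a finite_imp_compact[OF B(1)] disj bd]) blast+
  obtain D where D: "(?f ^^ n has_real_derivative D) (at p)" "\<rho> p \<le> \<theta> ^ n * \<bar>D\<bar> * \<rho> p"
    using quad_funpow_derivative[of Orb a \<rho> \<theta> p n] fO w a pO n(2) by auto
  have "0 < \<rho> p"
    using w(1) w(4)[OF pO] by linarith
  \<comment> \<open>The orbit returns to \<open>p\<close>, so both sides carry the same positive
    weight, which cancels.\<close>
  then have "1 \<le> \<theta> ^ n * \<bar>D\<bar>"
    using D(2) by (simp add: mult_le_cancel_right1)
  also have "\<dots> \<le> 1 * \<bar>D\<bar>"
    using w(2,3) by (intro mult_right_mono power_le_one) auto
  also have "\<dots> < 1"
    using d DERIV_imp_deriv[OF D(1)] by simp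
  finally show False
    by simp
qed

text \<open>For \<open>a > 2\<close> the repeller is defined without removing basins, so the
  critical orbit can be kept away from it only by escaping. Multiplication by
  \<open>- sqrt a\<close> conjugates the map to \<open>v \<mapsto> v\<^sup>2 - a\<close>, whose
  critical orbit is \<open>0, - a, a\<^sup>2 - a, ...\<close> and grows from the third point
  on.\<close>

lemma critical_orbit_escapes:
  assumes a: "2 < a"
  shows "filterlim (\<lambda>n. (quad a ^^ n) 0) at_infinity sequentially"
proof (rule filterlim_norm_at_top_imp_at_infinity)
  define s where "s = sqrt a"
  have s: "0 < s" "s\<^sup>2 = a"
    using a by (auto simp: s_def)
  define u where "u n = - s * (quad a ^^ n) 0" for n
  have step: "u (Suc n) = (u n)\<^sup>2 - a" for n
  proof -
    define z where "z = (quad a ^^ n) 0"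
    have "u (Suc n) = - (s\<^sup>2 * (1 - z\<^sup>2))"
      by (simp add: u_def quad_def s_def z_def power2_eq_square)
    also have "\<dots> = (u n)\<^sup>2 - s\<^sup>2"
      by (simp add: u_def z_def[symmetric] power_mult_distrib algebra_simps)
    finally show ?thesis
      unfolding s(2) .
  qed
  \<comment> \<open>\<open>t\<close> is \<open>u 2\<close>, and \<open>\<kappa>\<close> is the
    increment of \<open>v \<mapsto> v\<^sup>2 - a\<close> at \<open>t\<close>. Increments beyond
    \<open>t\<close> are no smaller, since the difference is \<open>(v - t) * (v + t - 1)\<close>;
    so growth is at least linear.\<close>
  define t where "t = a\<^sup>2 - a"
  define \<kappa> where "\<kappa> = t\<^sup>2 - a - t"
  have ta: "a < t"
    using a mult_strict_right_mono[of 1 "a - 1" a] by (simp add: t_def algebra_simps power2_eq_square)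
  have "1 * a < (t - 1) * t"
    using ta a by (intro mult_strict_mono) auto
  then have \<kappa>: "0 < \<kappa>"
    by (simp add: \<kappa>_def algebra_simps power2_eq_square)
  have grow: "t + real n * \<kappa> \<le> u (n + 2)" for n
  proof (induction n)
    case 0
    show ?case
      using step[of 0] step[of 1] by (simp add: u_def t_def numeral_2_eq_2)
  next
    case (Suc n)
    define v where "v = u (n + 2)"
    have "0 \<le> real n * \<kappa>"
      using \<kappa> by simp
    with Suc have v: "t \<le> v"
      unfolding v_def by linarith
    have "0 \<le> (v - t) * (v + t - 1)"
      using v ta a by (intro mult_nonneg_nonneg) auto
    then have "v + \<kappa> \<le> v\<^sup>2 - a"
      by (simp add: \<kappa>_def algebra_simps power2_eq_square)
    then show ?case
      using Suc step[of "n + 2"] by (simp add: v_def algebra_simps)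
  qed
  have "filterlim (\<lambda>n. (t + real n * \<kappa>) / s) at_top sequentially"
  proof -
    have "filterlim (\<lambda>n. t / s + \<kappa> / s * real n) at_top sequentially"
      using \<kappa> s by (intro filterlim_tendsto_add_at_top[OF tendsto_const]
          filterlim_tendsto_pos_mult_at_top[OF tendsto_const] filterlim_real_sequentially) auto
    then show ?thesis
      by (simp add: add_divide_distrib mult.commute)
  qed
  then have "filterlim (\<lambda>n. norm ((quad a ^^ (n + 2)) 0)) at_top sequentially"
  proof (rule filterlim_at_top_mono, intro always_eventually allI)
    fix n
    have "t + real n * \<kappa> \<le> \<bar>u (n + 2)\<bar>"
      using grow[of n] by linarith
    also have "\<dots> = s * \<bar>(quad a ^^ (n + 2)) 0\<bar>"
      using s by (simp add: u_def abs_mult)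
    finally show "(t + real n * \<kappa>) / s \<le> norm ((quad a ^^ (n + 2)) 0)"
      using s by (simp add: field_simps)
  qed
  then show "filterlim (\<lambda>n. norm ((quad a ^^ n) 0)) at_top sequentially"
    by (simp only: add_2_eq_Suc' filterlim_sequentially_Suc[of "\<lambda>n. norm ((quad a ^^ Suc n) 0)"]
        filterlim_sequentially_Suc[of "\<lambda>n. norm ((quad a ^^ n) 0)"])
qed

section \<open>Invariance and compactness of the repeller, and its distance from the critical
  orbit\<close>

lemma quad_repeller_step: "quad a x \<in> quad_repeller a \<longleftrightarrow> x \<in> quad_repeller a"
  unfolding quad_repeller_def
  using basin_step[of "quad a" x] forward_orbit_step[of "quad a" x] by auto

text \<open>An orbit is bounded exactly when it never leaves the ball of radius
  \<open>1 + 2 / sqrt a\<close>, which is a closed condition; the basins removed are open.\<close>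

lemma compact_quad_repeller:
  assumes a: "0 < a"
  shows "compact (quad_repeller a)"
proof -
  define R where "R = 1 + 2 / sqrt a"
  let ?K = "{x. bounded (forward_orbit (quad a) x)}"
  have K: "?K = (\<Inter>n. (quad a ^^ n) -` cball 0 R)"
  proof (intro equalityI subsetI)
    fix x assume x: "x \<in> ?K"
    have "\<bar>(quad a ^^ n) x\<bar> \<le> R" for n
    proof -
      have "(quad a ^^ n) x \<in> forward_orbit (quad a) x"
        by (simp add: forward_orbit_def)
      then have "bounded (forward_orbit (quad a) ((quad a ^^ n) x))"
        using x bounded_subset[OF _ forward_orbit_funpow] by simp
      from bounded_orbit_less[OF a this] show ?thesis
        by (simp add: R_def)
    qed
    then show "x \<in> (\<Inter>n. (quad a ^^ n) -` cball 0 R)"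
      by simp
  next
    fix x assume "x \<in> (\<Inter>n. (quad a ^^ n) -` cball 0 R)"
    then have "norm ((quad a ^^ n) x) \<le> R" for n
      by simp
    then have "\<forall>y\<in>forward_orbit (quad a) x. norm y \<le> R"
      unfolding forward_orbit_def by blast
    then show "x \<in> ?K"
      unfolding bounded_iff by blast
  qed
  have clK: "closed ?K"
    unfolding K by (intro closed_INT ballI closed_vimage continuous_on_funpow continuous_quad) auto
  have "?K \<subseteq> cball 0 R"
    using bounded_orbit_less[OF a] by (force simp: R_def)
  then have "bounded (quad_repeller a)"
    by (rule bounded_subset[OF bounded_cball, OF subset_trans[rotated]]) (auto simp: quad_repeller_def)
  moreover have "closed (quad_repeller a)"
  proof (cases "2 < a")
    case True
    with clK show ?thesis
      by (simp add: quad_repeller_def)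
  next
    case False
    then have "quad_repeller a = ?K \<inter> (\<Inter>p\<in>{p. attracting_periodic_point (quad a) p}.
        - basin (quad a) (forward_orbit (quad a) p))"
      by (auto simp: quad_repeller_def)
    then show ?thesis
      using attracting_basin(2)[OF continuous_quad differentiable_quad_funpow]
      by (auto intro!: closed_Int clK closed_INT)
  qed
  ultimately show ?thesis
    by (simp add: compact_eq_bounded_closed)
qed

text \<open>If the critical orbit escapes, it is closed and each of its points has an unbounded
  orbit. Otherwise \<open>a \<le> 2\<close>, an attracting orbit exists, and its basin contains the
  critical orbit together with its closure.\<close>

lemma quad_repeller_critical_orbit:
  assumes a: "0 < a" and hyp: "quad_hyperbolic a"
  shows "quad_repeller a \<inter> closure (forward_orbit (quad a) 0) = {}"
proof (cases "filterlim (\<lambda>n. (quad a ^^ n) 0) at_infinity sequentially")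
  case True
  then have cl: "closure (forward_orbit (quad a) 0) = forward_orbit (quad a) 0"
    by (simp add: forward_orbit_def at_infinity_imp_closed_range)
  have "x \<notin> quad_repeller a" if x: "x \<in> forward_orbit (quad a) 0" for x
  proof
    assume "x \<in> quad_repeller a"
    then have "bounded (forward_orbit (quad a) x)"
      by (auto simp: quad_repeller_def split: if_splits)
    obtain n where "x = (quad a ^^ n) 0"
      using x by (auto simp: forward_orbit_def)
    then have "(quad a ^^ m) x \<in> forward_orbit (quad a) x \<and> (quad a ^^ m) x = (quad a ^^ (m + n)) 0" for m
      by (auto simp: forward_orbit_def funpow_add)
    then have "bounded (range (\<lambda>m. (quad a ^^ (m + n)) 0))"
      by (intro bounded_subset[OF \<open>bounded (forward_orbit (quad a) x)\<close>]) (metis image_subsetI)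
    moreover have "filterlim (\<lambda>m. (quad a ^^ (m + n)) 0) at_infinity sequentially"
      by (rule filterlim_compose[OF True filterlim_add_const_nat_at_top])
    ultimately show False
      using at_infinity_imp_unbounded_range by blast
  qed
  with cl show ?thesis
    by auto
next
  case False
  then have a2: "\<not> 2 < a"
    using critical_orbit_escapes by blast
  from False hyp obtain p where p: "attracting_periodic_point (quad a) p"
    by (auto simp: quad_hyperbolic_def)
  obtain e where e: "0 < e" "{z. infdist z (forward_orbit (quad a) p) \<le> e} \<subseteq>
      basin (quad a) (forward_orbit (quad a) p)"
    using attracting_basin(3)[OF continuous_quad differentiable_quad_funpow p] by blast
  have "closure (forward_orbit (quad a) 0) \<subseteq> basin (quad a) (forward_orbit (quad a) p)"
    by (rule closure_orbit_subset_basin[OF e critical_point_in_attracting_basin[OF a p]])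
  with p a2 show ?thesis
    by (auto simp: quad_repeller_def)
qed

subsection \<open>Continuation of singular orbits\<close>

text \<open>For \<open>d\<close> the supremum, the sitewise estimate becomes
  \<open>d \<le> A + \<kappa> * d\<close>; boundedness makes \<open>d\<close> finite, so the last
  term can be absorbed. With \<open>A = 0\<close> this yields uniqueness, with \<open>A\<close> a
  source term it bounds the inverse derivative.\<close>

lemma affine_contraction_bound:
  fixes e :: "'a \<Rightarrow> real"
  assumes "bdd_above (range e)" "\<kappa> < 1"
    and step: "\<And>d. (\<And>i. e i \<le> d) \<Longrightarrow> (\<And>i. e i \<le> A + \<kappa> * d)"
  shows "e i \<le> A / (1 - \<kappa>)"
proof -
  define d where "d = (SUP i. e i)"
  have le: "e i \<le> d" for i
    unfolding d_def using assms(1) by (intro cSUP_upper) auto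
  have "d \<le> A + \<kappa> * d"
    unfolding d_def using step[OF le] by (intro cSUP_least) (auto simp: d_def)
  then have "d * (1 - \<kappa>) \<le> A"
    by (simp add: algebra_simps)
  then have "d \<le> A / (1 - \<kappa>)"
    using assms(2) by (simp add: pos_le_divide_eq)
  with le[of i] show ?thesis
    by linarith
qed

lemma bcontfun_discreteI:
  fixes f :: "'a::discrete_topology \<Rightarrow> real"
  assumes "\<And>i. \<bar>f i\<bar> \<le> B"
  shows "f \<in> bcontfun"
  by (rule bcontfun_normI[where b = B]) (use assms in auto)

text \<open>The library's completeness instance asks for a metric domain, which \<open>int\<close> is not.\<close>
lemma complete_linf: "complete (UNIV :: linf set)"
proof (rule completeI)
  fix f :: "nat \<Rightarrow> linf" assume "Cauchy f"
  then obtain g where g: "uniform_limit UNIV f g sequentially"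
    using uniformly_convergent_eq_cauchy[of "\<lambda>_. True" f]
    unfolding Cauchy_def uniform_limit_sequentially_iff
    by (metis dist_fun_lt_imp_dist_val_lt)
  have near: "\<exists>N. \<forall>n\<ge>N. \<forall>i. dist (f n i) (g i) < e" if "0 < e" for e
    using g that unfolding uniform_limit_sequentially_iff by blast
  obtain N where "\<And>i. dist (f N i) (g i) < 1"
    using near[of 1] by auto
  then have "\<bar>g i\<bar> \<le> norm (f N) + 1" for i
    using norm_bounded[of "f N" i] by (smt (verit) dist_real_def real_norm_def)
  then have "g \<in> bcontfun"
    by (rule bcontfun_discreteI)
  then obtain l where l: "g = apply_bcontfun l"
    by (rule bcontfunE)
  have "f \<longlonglongrightarrow> l"
  proof (rule metric_LIMSEQ_I)
    fix e :: real assume "0 < e"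
    then obtain N where "\<And>n i. N \<le> n \<Longrightarrow> dist (f n i) (g i) < e / 2"
      using near[of "e / 2"] by auto
    then have "dist (f n) l \<le> e / 2" if "N \<le> n" for n
      using that by (intro dist_bound) (auto simp: l intro: less_imp_le)
    then show "\<exists>N. \<forall>n\<ge>N. dist (f n) l < e"
      using \<open>0 < e\<close> by (intro exI[of _ N]) force
  qed
  then show "\<exists>l\<in>UNIV. f \<longlonglongrightarrow> l"
    by blast
qed

text \<open>Substituting \<open>u i = \<rho> i * v i\<close> turns the weighted ball into an
  ordinary ball of \<open>linf\<close>, where Banach's theorem applies. The slack
  \<open>(1 - \<kappa>) * \<eta>\<close> at zero makes the ball invariant.\<close>

lemma weighted_fixed_point:
  fixes \<Phi> :: "(int \<Rightarrow> real) \<Rightarrow> int \<Rightarrow> real" and \<rho> :: "int \<Rightarrow> real"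
  assumes \<rho>: "\<And>i. 0 < \<rho> i" and \<kappa>: "0 \<le> \<kappa>" "\<kappa> < 1" and \<eta>: "0 \<le> \<eta>"
    and lip: "\<And>v w d i. (\<And>i. \<rho> i * \<bar>v i\<bar> \<le> \<eta>) \<Longrightarrow> (\<And>i. \<rho> i * \<bar>w i\<bar> \<le> \<eta>) \<Longrightarrow>
      (\<And>i. \<rho> i * \<bar>v i - w i\<bar> \<le> d) \<Longrightarrow> \<rho> i * \<bar>\<Phi> v i - \<Phi> w i\<bar> \<le> \<kappa> * d"
    and zero: "\<And>i. \<rho> i * \<bar>\<Phi> (\<lambda>_. 0) i\<bar> \<le> (1 - \<kappa>) * \<eta>"
  shows "\<exists>v. (\<forall>i. \<rho> i * \<bar>v i\<bar> \<le> \<eta>) \<and> (\<forall>i. \<Phi> v i = v i)"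
proof -
  define V :: "linf \<Rightarrow> int \<Rightarrow> real" where "V u = (\<lambda>i. u i / \<rho> i)" for u
  define G :: "linf \<Rightarrow> linf" where "G u = Bcontfun (\<lambda>i. \<rho> i * \<Phi> (V u) i)" for u
  have V: "\<rho> i * \<bar>V u i\<bar> \<le> \<eta>" if "u \<in> cball 0 \<eta>" for u i
    using norm_bounded[of u i] that \<rho>[of i] by (simp add: V_def)
  have bd: "\<bar>\<rho> i * \<Phi> (V u) i\<bar> \<le> \<eta>" if u: "u \<in> cball 0 \<eta>" for u i
  proof -
    have "\<rho> i * \<bar>\<Phi> (V u) i - \<Phi> (\<lambda>_. 0) i\<bar> \<le> \<kappa> * \<eta>"
      using V[OF u] \<eta> by (intro lip) auto
    moreover have "\<rho> i * \<bar>\<Phi> (V u) i\<bar> \<le> \<rho> i * \<bar>\<Phi> (V u) i - \<Phi> (\<lambda>_. 0) i\<bar> + \<rho> i * \<bar>\<Phi> (\<lambda>_. 0) i\<bar>"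
      unfolding distrib_left[symmetric] using \<rho>[of i] by (intro mult_left_mono) auto
    ultimately show ?thesis
      using zero[of i] \<rho>[of i] by (simp add: abs_mult algebra_simps)
  qed
  have G: "G u i = \<rho> i * \<Phi> (V u) i" if "u \<in> cball 0 \<eta>" for u i
  proof -
    have "(\<lambda>i. \<rho> i * \<Phi> (V u) i) \<in> bcontfun"
      by (rule bcontfun_discreteI) (rule bd[OF that])
    then show ?thesis
      by (simp add: G_def Bcontfun_inverse)
  qed
  have "\<exists>!u\<in>cball 0 \<eta>. G u = u"
  proof (rule Banach_fix[OF _ _ \<kappa>])
    show "complete (cball (0::linf) \<eta>)"
      using complete_Int_closed[OF complete_linf closed_cball] by simp
    show "cball (0::linf) \<eta> \<noteq> {}"
      using \<eta> by simp
    show "G ` cball 0 \<eta> \<subseteq> cball 0 \<eta>"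
      using bd G by (auto intro!: norm_bound)
    fix u w :: linf assume u: "u \<in> cball 0 \<eta>" and w: "w \<in> cball 0 \<eta>"
    show "dist (G u) (G w) \<le> \<kappa> * dist u w"
    proof (rule dist_bound)
      fix i
      have "\<rho> j * \<bar>V u j - V w j\<bar> \<le> dist u w" for j
      proof -
        have "\<rho> j * \<bar>V u j - V w j\<bar> = \<bar>u j - w j\<bar>"
          using \<rho>[of j] by (simp add: V_def flip: diff_divide_distrib)
        then show ?thesis
          using dist_bounded[of u j w] by (simp add: dist_real_def)
      qed
      from lip[OF V[OF u] V[OF w] this, of i]
      show "dist (G u i) (G w i) \<le> \<kappa> * dist u w"
        using \<rho>[of i] by (simp add: G[OF u] G[OF w] dist_real_def abs_mult flip: right_diff_distrib)
    qed
  qed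
  then obtain u where u: "u \<in> cball 0 \<eta>" "G u = u"
    by blast
  have "\<Phi> (V u) i = V u i" for i
    using G[OF u(1), of i] \<rho>[of i] unfolding u(2) by (simp add: V_def field_simps)
  with V[OF u(1)] show ?thesis
    by blast
qed

text \<open>The lower bound gives injectivity and, read at \<open>E w\<close>, bounds the inverse by
  the same constant \<open>C\<close>.\<close>

lemma bounded_linear_inverse_exists:
  fixes D :: "'a::real_normed_vector \<Rightarrow> 'b::real_normed_vector"
  assumes D: "bounded_linear D" and below: "\<And>v. norm v \<le> C * norm (D v)" and surj: "\<And>w. \<exists>v. D v = w"
  shows "\<exists>E. bounded_linear E \<and> D \<circ> E = id \<and> E \<circ> D = id"
proof -
  interpret D: bounded_linear D
    by fact
  have inj: "v = w" if "D v = D w" for v w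
    using below[of "v - w"] that by (simp add: D.diff)
  define E where "E = inv D"
  have DE: "D (E w) = w" for w
    using surj[of w] unfolding E_def by (auto intro: f_inv_into_f)
  have ED: "E (D v) = v" for v
    by (rule inj) (rule DE)
  have "bounded_linear E"
  proof (rule bounded_linear_intro)
    show "E (x + y) = E x + E y" for x y
      by (rule inj) (simp add: DE D.add)
    show "E (c *\<^sub>R x) = c *\<^sub>R E x" for c x
      by (rule inj) (simp add: DE D.scaleR)
    show "norm (E x) \<le> norm x * C" for x
      using below[of "E x"] by (simp add: DE mult.commute)
  qed
  with DE ED show ?thesis
    by (intro exI[of _ E]) (auto simp: fun_eq_iff)
qed

text \<open>The zero equation on plain functions, which carry the product topology. The value
  \<open>q\<close> replaces \<open>r \<epsilon>\<close>, so the estimates see only the numbers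
  \<open>\<epsilon>\<close> and \<open>q - rh\<close>.\<close>

definition henon_seq :: "real \<Rightarrow> real \<Rightarrow> (int \<Rightarrow> real) \<Rightarrow> bool" where
  "henon_seq \<epsilon> q x \<longleftrightarrow> (\<forall>i. \<epsilon> * x (i + 1) - (1 - (x i)\<^sup>2) + q * x (i - 1) = 0)"

lemma henon_seqD: "henon_seq \<epsilon> q x \<Longrightarrow> \<epsilon> * x (i + 1) - (1 - (x i)\<^sup>2) + q * x (i - 1) = 0"
  by (simp add: henon_seq_def)

text \<open>One step of the relation \<open>rh * y = 1 - x\<^sup>2\<close> expands the weighted length, so solving the linearised
equation along a singular orbit for \<open>v i\<close> in terms of \<open>v (i - 1)\<close> contracts in the norm
\<open>SUP i. \<rho> (x i) * \<bar>v i\<bar>\<close>.\<close>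
locale weighted_repeller =
  fixes Lam :: "real set" and rh :: real and \<rho> :: "real \<Rightarrow> real" and m M \<theta> :: real
  assumes compact_Lam: "compact Lam" and zero_Lam: "0 \<notin> Lam"
    and pos: "0 < m" "0 < M" "0 < \<theta>" "\<theta> < 1"
    and weight_bounds: "\<And>x. x \<in> Lam \<Longrightarrow> m \<le> \<rho> x" "\<And>x. x \<in> Lam \<Longrightarrow> \<rho> x \<le> M"
    and contraction: "\<And>x y. x \<in> Lam \<Longrightarrow> y \<in> Lam \<Longrightarrow> rh * y = 1 - x\<^sup>2 \<Longrightarrow>
      \<bar>rh\<bar> * \<rho> x \<le> \<theta> * (2 * \<bar>x\<bar>) * \<rho> y"
begin

definition orbits :: "(int \<Rightarrow> real) set" where
  "orbits = {x. henon_seq 0 rh x \<and> (\<forall>i. x i \<in> Lam)}"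

lemma orbits_step: "x \<in> orbits \<Longrightarrow> rh * x (i - 1) = 1 - (x i)\<^sup>2"
  using henon_seqD[of 0 rh x i] by (auto simp: orbits_def)

text \<open>With \<open>t = \<bar>v (i - 1)\<bar>\<close> this controls the coupling term
  \<open>rh * v (i - 1) / (2 * x i)\<close> of the linearised equation, the only one that need not
  be small.\<close>

lemma orbits_contraction:
  assumes x: "x \<in> orbits" and "0 \<le> t" "\<rho> (x (i - 1)) * t \<le> d"
  shows "\<rho> (x i) * (\<bar>rh\<bar> * t / (2 * \<bar>x i\<bar>)) \<le> \<theta> * d"
proof -
  have xL: "x i \<in> Lam" "x (i - 1) \<in> Lam"
    using x by (auto simp: orbits_def)
  then have n0: "x i \<noteq> 0"
    using zero_Lam by metis
  have "\<bar>rh\<bar> * \<rho> (x i) * t \<le> \<theta> * (2 * \<bar>x i\<bar>) * \<rho> (x (i - 1)) * t"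
    using contraction[OF xL orbits_step[OF x]] assms(2) by (intro mult_right_mono) auto
  also have "\<dots> = \<theta> * (2 * \<bar>x i\<bar>) * (\<rho> (x (i - 1)) * t)"
    by simp
  also have "\<dots> \<le> \<theta> * (2 * \<bar>x i\<bar>) * d"
    using assms(3) pos by (intro mult_left_mono) auto
  finally show ?thesis
    using n0 by (simp add: field_simps)
qed

lemma Lam_bounds:
  obtains c B where "0 < c" "0 < B" "\<And>x. x \<in> Lam \<Longrightarrow> c \<le> \<bar>x\<bar>" "\<And>x. x \<in> Lam \<Longrightarrow> \<bar>x\<bar> \<le> B"
proof -
  have "open (- Lam)"
    using compact_Lam by (simp add: compact_imp_closed open_Compl)
  then obtain c where c: "0 < c" "ball 0 c \<subseteq> - Lam"
    using zero_Lam by (meson ComplI open_contains_ball)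
  obtain B where B: "0 < B" "\<And>x. x \<in> Lam \<Longrightarrow> norm x \<le> B"
    using compact_imp_bounded[OF compact_Lam] by (auto simp: bounded_pos)
  have "c \<le> \<bar>x\<bar>" if "x \<in> Lam" for x
    using c(2) that by (force simp: not_less[symmetric] subset_iff)
  with c(1) B that show ?thesis
    by auto
qed

text \<open>Handles everything in the equation other than the coupling term, after division by
  \<open>2 * x i\<close>.\<close>

lemma weight_source_bound:
  assumes "x \<in> Lam" "0 < c" "c \<le> \<bar>x\<bar>" "\<bar>u\<bar> \<le> b"
  shows "\<rho> x * (\<bar>u\<bar> / (2 * \<bar>x\<bar>)) \<le> M * b / (2 * c)"
proof -
  have "\<rho> x * (\<bar>u\<bar> / (2 * \<bar>x\<bar>)) \<le> M * (b / (2 * c))"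
    using assms pos weight_bounds[OF assms(1)]
    by (intro mult_mono frac_le) auto
  then show ?thesis
    by simp
qed

text \<open>All constants come from the bounds on \<open>Lam\<close> and the weight, whence the
  uniformity in \<open>xd\<close>. Existence holds within \<open>\<delta>\<close> but uniqueness
  within \<open>2 * \<delta>\<close>: the larger radius also separates distinct singular
  orbits.\<close>

lemma perturbation:
  obtains s0 \<delta> C where "0 < s0" "0 < \<delta>" "0 \<le> C"
    "\<And>xd \<epsilon> q. xd \<in> orbits \<Longrightarrow> \<bar>\<epsilon>\<bar> + \<bar>q - rh\<bar> \<le> s0 \<Longrightarrow>
      C * (\<bar>\<epsilon>\<bar> + \<bar>q - rh\<bar>) < \<delta> \<and>
      (\<exists>x. henon_seq \<epsilon> q x \<and> (\<forall>i. \<bar>x i - xd i\<bar> \<le> C * (\<bar>\<epsilon>\<bar> + \<bar>q - rh\<bar>)))"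
    "\<And>xd \<epsilon> q x y. xd \<in> orbits \<Longrightarrow> \<bar>\<epsilon>\<bar> + \<bar>q - rh\<bar> \<le> s0 \<Longrightarrow> henon_seq \<epsilon> q x \<Longrightarrow> henon_seq \<epsilon> q y \<Longrightarrow>
      (\<And>i. \<bar>x i - xd i\<bar> \<le> 2 * \<delta>) \<Longrightarrow> (\<And>i. \<bar>y i - xd i\<bar> \<le> 2 * \<delta>) \<Longrightarrow> x = y"
proof -
  obtain c B where cB: "0 < c" "0 < B" "\<And>x. x \<in> Lam \<Longrightarrow> c \<le> \<bar>x\<bar>" "\<And>x. x \<in> Lam \<Longrightarrow> \<bar>x\<bar> \<le> B"
    by (rule Lam_bounds) blast
  \<comment> \<open>\<open>K\<close> converts a source term measured in the sup norm into the
    weighted norm. Then \<open>\<delta>\<close> and \<open>s0\<close> are such that both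
    \<open>4 * K * \<delta>\<close> and \<open>K * s0\<close> are at most
    \<open>(1 - \<theta>) / 4\<close>, which raises the rate from \<open>\<theta>\<close> to only
    \<open>\<kappa> = (1 + \<theta>) / 2\<close>.\<close>
  define K where "K = M / (2 * c * m)"
  have K: "0 < K"
    using pos cB by (simp add: K_def)
  define \<delta> where "\<delta> = (1 - \<theta>) / (16 * K)"
  have \<delta>: "0 < \<delta>"
    using K pos by (simp add: \<delta>_def)
  have K\<delta>: "K * \<delta> = (1 - \<theta>) / 16"
    using K by (simp add: \<delta>_def)
  \<comment> \<open>Solves \<open>M * (s * B) / (2 * c) = (1 - \<kappa>) * (m * (C * s))\<close>,
    the self-map condition of the fixed point lemma at zero.\<close>
  define C where "C = 2 * K * B / (1 - \<theta>)"
  have C: "0 < C"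
    using K cB pos by (simp add: C_def)
  define s0 where "s0 = min ((1 - \<theta>) / (4 * K)) (\<delta> / (2 * C))"
  have s0: "0 < s0"
    using K \<delta> C pos by (simp add: s0_def)
  define \<kappa> where "\<kappa> = (1 + \<theta>) / 2"
  have \<kappa>: "0 \<le> \<kappa>" "\<kappa> < 1"
    using pos by (auto simp: \<kappa>_def)
  \<comment> \<open>Insert \<open>xd + v\<close> into the equation, cancel the singular relation for
    \<open>xd\<close>, and solve the linear term \<open>2 * xd i * v i\<close> for
    \<open>v i\<close>.\<close>
  define \<Phi> where "\<Phi> \<epsilon> q xd v i =
    - (\<epsilon> * (xd (i + 1) + v (i + 1)) + (v i)\<^sup>2 + (q - rh) * xd (i - 1) + q * v (i - 1)) / (2 * xd i)"
    for \<epsilon> q and xd v :: "int \<Rightarrow> real" and i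
  have xL: "xd i \<in> Lam" "xd i \<noteq> 0" "c \<le> \<bar>xd i\<bar>" "\<bar>xd i\<bar> \<le> B" "0 < \<rho> (xd i)" if "xd \<in> orbits" for xd i
  proof -
    show L: "xd i \<in> Lam"
      using that by (auto simp: orbits_def)
    then show "c \<le> \<bar>xd i\<bar>" "\<bar>xd i\<bar> \<le> B"
      using cB by auto
    then show "xd i \<noteq> 0"
      using cB(1) by auto
    show "0 < \<rho> (xd i)"
      using weight_bounds(1)[OF L] pos(1) by linarith
  qed
  have fix_iff: "\<Phi> \<epsilon> q xd v i = v i \<longleftrightarrow>
      \<epsilon> * (xd (i + 1) + v (i + 1)) - (1 - (xd i + v i)\<^sup>2) + q * (xd (i - 1) + v (i - 1)) = 0"
    if xd: "xd \<in> orbits" for xd \<epsilon> q v i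
    using orbits_step[OF xd, of i] xL(2)[OF xd, of i]
    by (simp add: \<Phi>_def field_simps power2_eq_square) argo
  have lip: "\<rho> (xd i) * \<bar>\<Phi> \<epsilon> q xd v i - \<Phi> \<epsilon> q xd w i\<bar> \<le> \<kappa> * d"
    if xd: "xd \<in> orbits" and s: "\<bar>\<epsilon>\<bar> + \<bar>q - rh\<bar> \<le> s0" and vw: "\<And>i. \<bar>v i\<bar> \<le> 2 * \<delta>" "\<And>i. \<bar>w i\<bar> \<le> 2 * \<delta>"
      and d: "\<And>i. \<rho> (xd i) * \<bar>v i - w i\<bar> \<le> d" for xd \<epsilon> q v w d i
  proof -
    define e where "e j = v j - w j" for j
    have e: "\<rho> (xd j) * \<bar>e j\<bar> \<le> d" for j
      using d by (simp add: e_def)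
    have e': "\<bar>e j\<bar> \<le> d / m" for j
    proof -
      have "m * \<bar>e j\<bar> \<le> \<rho> (xd j) * \<bar>e j\<bar>"
        using weight_bounds(1)[OF xL(1)[OF xd]] by (intro mult_right_mono) auto
      with e[of j] have "m * \<bar>e j\<bar> \<le> d"
        by linarith
      then show ?thesis
        using pos by (simp add: field_simps)
    qed
    then have dm: "0 \<le> d / m"
      using abs_ge_zero order_trans by blast
    \<comment> \<open>The difference of the two images splits into the coupling term with
      \<open>rh\<close> and this remainder, whose coefficients are small: \<open>s0\<close> from the
      parameters, \<open>4 * \<delta>\<close> from
      \<open>(v i)\<^sup>2 - (w i)\<^sup>2 = (v i + w i) * e i\<close>.\<close>
    define u where "u = \<epsilon> * e (i + 1) + (v i + w i) * e i + (q - rh) * e (i - 1)"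
    have u: "\<bar>u\<bar> \<le> (s0 + 4 * \<delta>) * (d / m)"
    proof -
      have "\<bar>v i + w i\<bar> \<le> 4 * \<delta>"
        using vw(1)[of i] vw(2)[of i] by linarith
      then have "\<bar>(v i + w i) * e i\<bar> \<le> (4 * \<delta>) * (d / m)"
        unfolding abs_mult using e' \<delta> by (intro mult_mono) auto
      moreover have "\<bar>\<epsilon> * e (i + 1)\<bar> \<le> \<bar>\<epsilon>\<bar> * (d / m)" "\<bar>(q - rh) * e (i - 1)\<bar> \<le> \<bar>q - rh\<bar> * (d / m)"
        unfolding abs_mult by (intro mult_left_mono e' abs_ge_zero)+
      moreover have "(\<bar>\<epsilon>\<bar> + \<bar>q - rh\<bar>) * (d / m) \<le> s0 * (d / m)"
        using s dm by (rule mult_right_mono)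
      ultimately show ?thesis
        unfolding u_def distrib_right by linarith
    qed
    have "\<Phi> \<epsilon> q xd v i - \<Phi> \<epsilon> q xd w i = - (u / (2 * xd i)) - rh * e (i - 1) / (2 * xd i)"
      unfolding \<Phi>_def u_def e_def using xL(2)[OF xd, of i]
      by (simp add: field_simps power2_eq_square)
    then have "\<bar>\<Phi> \<epsilon> q xd v i - \<Phi> \<epsilon> q xd w i\<bar> \<le> \<bar>u / (2 * xd i)\<bar> + \<bar>rh * e (i - 1) / (2 * xd i)\<bar>"
      by linarith
    then have "\<rho> (xd i) * \<bar>\<Phi> \<epsilon> q xd v i - \<Phi> \<epsilon> q xd w i\<bar> \<le>
        \<rho> (xd i) * (\<bar>u / (2 * xd i)\<bar> + \<bar>rh * e (i - 1) / (2 * xd i)\<bar>)"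
      using xL(5)[OF xd, of i] by (intro mult_left_mono) auto
    also have "\<dots> = \<rho> (xd i) * (\<bar>u\<bar> / (2 * \<bar>xd i\<bar>)) + \<rho> (xd i) * (\<bar>rh\<bar> * \<bar>e (i - 1)\<bar> / (2 * \<bar>xd i\<bar>))"
      by (simp add: abs_mult distrib_left)
    also have "\<dots> \<le> M * ((s0 + 4 * \<delta>) * (d / m)) / (2 * c) + \<theta> * d"
      by (intro add_mono weight_source_bound[OF xL(1)[OF xd] cB(1) xL(3)[OF xd] u]
          orbits_contraction[OF xd _ e]) auto
    also have "M * ((s0 + 4 * \<delta>) * (d / m)) / (2 * c) = (K * s0 + 4 * (K * \<delta>)) * d"
      using pos cB by (simp add: K_def field_simps)
    also have "\<dots> + \<theta> * d \<le> \<kappa> * d"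
    proof -
      have "K * s0 \<le> K * ((1 - \<theta>) / (4 * K))"
        using K by (intro mult_left_mono) (auto simp: s0_def)
      also have "\<dots> = (1 - \<theta>) / 4"
        using K by simp
      finally have "K * s0 + 4 * (K * \<delta>) + \<theta> \<le> \<kappa>"
        unfolding K\<delta> \<kappa>_def by (simp add: field_simps)
      moreover have "0 \<le> d"
        using dm pos by (simp add: zero_le_divide_iff)
      ultimately show ?thesis
        unfolding distrib_right[symmetric] by (rule mult_right_mono)
    qed
    finally show ?thesis .
  qed
  show ?thesis
  proof (rule that[OF s0 \<delta> less_imp_le[OF C]])
    fix xd \<epsilon> q assume xd: "xd \<in> orbits" and s: "\<bar>\<epsilon>\<bar> + \<bar>q - rh\<bar> \<le> s0"
    define s where "s = \<bar>\<epsilon>\<bar> + \<bar>q - rh\<bar>"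
    have "C * s \<le> C * (\<delta> / (2 * C))"
      using s C by (intro mult_left_mono) (auto simp: s_def s0_def)
    then have Cs: "C * s \<le> \<delta> / 2"
      using C by simp
    have s_nonneg: "0 \<le> s"
      by (simp add: s_def)
    \<comment> \<open>As the weight is at least \<open>m\<close>, the weighted ball of radius
      \<open>\<eta>\<close> lies in the sup-norm ball of radius \<open>C * s\<close>.\<close>
    define \<eta> where "\<eta> = m * (C * s)"
    have "\<exists>v. (\<forall>i. \<rho> (xd i) * \<bar>v i\<bar> \<le> \<eta>) \<and> (\<forall>i. \<Phi> \<epsilon> q xd v i = v i)"
    proof (rule weighted_fixed_point[OF xL(5)[OF xd] \<kappa>])
      show "0 \<le> \<eta>"
        using pos C s_nonneg by (simp add: \<eta>_def)
      have small: "\<bar>v i\<bar> \<le> 2 * \<delta>" if "\<And>i. \<rho> (xd i) * \<bar>v i\<bar> \<le> \<eta>" for v i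
      proof -
        have "m * \<bar>v i\<bar> \<le> \<rho> (xd i) * \<bar>v i\<bar>"
          using weight_bounds(1)[OF xL(1)[OF xd]] by (intro mult_right_mono) auto
        also have "\<dots> \<le> m * (C * s)"
          using that by (simp add: \<eta>_def)
        finally show ?thesis
          using pos Cs \<delta> by simp
      qed
      show "\<rho> (xd i) * \<bar>\<Phi> \<epsilon> q xd v i - \<Phi> \<epsilon> q xd w i\<bar> \<le> \<kappa> * d"
        if "\<And>i. \<rho> (xd i) * \<bar>v i\<bar> \<le> \<eta>" "\<And>i. \<rho> (xd i) * \<bar>w i\<bar> \<le> \<eta>"
          "\<And>i. \<rho> (xd i) * \<bar>v i - w i\<bar> \<le> d" for v w d i
        using lip[OF xd s small[OF that(1)] small[OF that(2)] that(3)] .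
      fix i
      have "\<bar>\<epsilon> * xd (i + 1) + (q - rh) * xd (i - 1)\<bar> \<le> \<bar>\<epsilon> * xd (i + 1)\<bar> + \<bar>(q - rh) * xd (i - 1)\<bar>"
        by linarith
      also have "\<dots> \<le> \<bar>\<epsilon>\<bar> * B + \<bar>q - rh\<bar> * B"
        unfolding abs_mult by (intro add_mono mult_left_mono xL(4)[OF xd]) auto
      finally have "\<bar>\<epsilon> * xd (i + 1) + (q - rh) * xd (i - 1)\<bar> \<le> s * B"
        by (simp add: s_def algebra_simps)
      from weight_source_bound[OF xL(1)[OF xd] cB(1) xL(3)[OF xd] this, of i]
      moreover have "\<bar>\<Phi> \<epsilon> q xd (\<lambda>_. 0) i\<bar> =
          \<bar>\<epsilon> * xd (i + 1) + (q - rh) * xd (i - 1)\<bar> / (2 * \<bar>xd i\<bar>)"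
        unfolding \<Phi>_def abs_divide abs_minus_cancel by (simp add: abs_mult)
      ultimately have "\<rho> (xd i) * \<bar>\<Phi> \<epsilon> q xd (\<lambda>_. 0) i\<bar> \<le> M * (s * B) / (2 * c)"
        by simp
      also have "\<dots> = (1 - \<kappa>) * \<eta>"
        using pos cB by (simp add: \<eta>_def C_def K_def \<kappa>_def field_simps)
      finally show "\<rho> (xd i) * \<bar>\<Phi> \<epsilon> q xd (\<lambda>_. 0) i\<bar> \<le> (1 - \<kappa>) * \<eta>" .
    qed
    then obtain v where v: "\<And>i. \<rho> (xd i) * \<bar>v i\<bar> \<le> \<eta>" "\<And>i. \<Phi> \<epsilon> q xd v i = v i"
      by blast
    have "\<bar>v i\<bar> \<le> C * s" for i
    proof -
      have "m * \<bar>v i\<bar> \<le> \<rho> (xd i) * \<bar>v i\<bar>"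
        using weight_bounds(1)[OF xL(1)[OF xd]] by (intro mult_right_mono) auto
      with v(1)[of i] have "m * \<bar>v i\<bar> \<le> m * (C * s)"
        by (simp add: \<eta>_def)
      then show ?thesis
        using pos by simp
    qed
    moreover have "henon_seq \<epsilon> q (\<lambda>i. xd i + v i)"
      using v(2) fix_iff[OF xd] by (simp add: henon_seq_def)
    ultimately show "C * (\<bar>\<epsilon>\<bar> + \<bar>q - rh\<bar>) < \<delta> \<and>
        (\<exists>x. henon_seq \<epsilon> q x \<and> (\<forall>i. \<bar>x i - xd i\<bar> \<le> C * (\<bar>\<epsilon>\<bar> + \<bar>q - rh\<bar>)))"
      using Cs \<delta> unfolding s_def[symmetric] by (intro conjI exI[of _ "\<lambda>i. xd i + v i"]) auto
  next
    fix xd \<epsilon> q x y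
    assume xd: "xd \<in> orbits" and s: "\<bar>\<epsilon>\<bar> + \<bar>q - rh\<bar> \<le> s0"
      and x: "henon_seq \<epsilon> q x" and y: "henon_seq \<epsilon> q y"
      and xs: "\<And>i. \<bar>x i - xd i\<bar> \<le> 2 * \<delta>" and ys: "\<And>i. \<bar>y i - xd i\<bar> \<le> 2 * \<delta>"
    have fp: "\<Phi> \<epsilon> q xd (\<lambda>i. z i - xd i) i = z i - xd i" if "henon_seq \<epsilon> q z" for z i
      using henon_seqD[OF that, of i] fix_iff[OF xd, of \<epsilon> q "\<lambda>i. z i - xd i" i] by simp
    have "\<rho> (xd i) * \<bar>x i - y i\<bar> \<le> 0 / (1 - \<kappa>)" for i
    proof (rule affine_contraction_bound[where e = "\<lambda>i. \<rho> (xd i) * \<bar>x i - y i\<bar>", OF _ \<kappa>(2)])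
      have "\<rho> (xd i) * \<bar>x i - y i\<bar> \<le> M * (4 * \<delta>)" for i
        using weight_bounds(2)[OF xL(1)[OF xd]] xs[of i] ys[of i] pos by (intro mult_mono) auto
      then show "bdd_above (range (\<lambda>i. \<rho> (xd i) * \<bar>x i - y i\<bar>))"
        by (intro bdd_aboveI) auto
      fix d i assume "\<And>i. \<rho> (xd i) * \<bar>x i - y i\<bar> \<le> d"
      with lip[OF xd s, where v = "\<lambda>i. x i - xd i" and w = "\<lambda>i. y i - xd i" and d = d and i = i] xs ys
      show "\<rho> (xd i) * \<bar>x i - y i\<bar> \<le> 0 + \<kappa> * d"
        by (simp add: fp[OF x] fp[OF y])
    qed
    then have le: "\<rho> (xd i) * \<bar>x i - y i\<bar> \<le> 0" for i
      by simp
    have "x i = y i" for i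
      using le[of i] xL(5)[OF xd, of i] by (simp add: mult_le_0_iff)
    then show "x = y"
      by blast
  qed
qed

end

section \<open>Non-degeneracy of singular orbits\<close>

context weighted_repeller
begin

text \<open>The derivative sends \<open>v\<close> to \<open>2 * x i * v i + rh * v (i - 1)\<close>,
  and the remainder is exactly \<open>(v i)\<^sup>2\<close>. Solved for \<open>v i\<close>, the
  equation \<open>D v = w\<close> is an affine \<open>\<theta>\<close>-contraction in the weighted
  norm: this gives the lower bound for \<open>D\<close> and, through a fixed point,
  surjectivity.\<close>

lemma nondegenerate:
  assumes x: "apply_bcontfun x \<in> orbits" and r: "r 0 = rh"
  shows "nondegenerate_zero (F r 0) x"
proof -
  obtain c B where cB: "0 < c" "0 < B" "\<And>x. x \<in> Lam \<Longrightarrow> c \<le> \<bar>x\<bar>" "\<And>x. x \<in> Lam \<Longrightarrow> \<bar>x\<bar> \<le> B"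
    by (rule Lam_bounds) blast
  have xL: "x i \<in> Lam" "x i \<noteq> 0" "c \<le> \<bar>x i\<bar>" "\<bar>x i\<bar> \<le> B" "0 < \<rho> (x i)" for i
  proof -
    show L: "x i \<in> Lam"
      using x by (auto simp: orbits_def)
    then show "c \<le> \<bar>x i\<bar>" "\<bar>x i\<bar> \<le> B"
      using cB by auto
    then show "x i \<noteq> 0"
      using cB(1) by auto
    show "0 < \<rho> (x i)"
      using weight_bounds(1)[OF L] pos(1) by linarith
  qed
  define D :: "linf \<Rightarrow> linf" where "D v = Bcontfun (\<lambda>i. 2 * x i * v i + rh * v (i - 1))" for v
  have D_bound: "\<bar>2 * x i * v i + rh * v (i - 1)\<bar> \<le> norm v * (2 * B + \<bar>rh\<bar>)" for v :: linf and i
  proof -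
    have "\<bar>v j\<bar> \<le> norm v" for j
      using norm_bounded[of v j] by simp
    then have "\<bar>2 * x i * v i\<bar> \<le> 2 * B * norm v" "\<bar>rh * v (i - 1)\<bar> \<le> \<bar>rh\<bar> * norm v"
      unfolding abs_mult using xL(4)[of i] cB(2) by (auto intro!: mult_mono mult_left_mono)
    then show ?thesis
      unfolding distrib_left by (simp add: ac_simps)
  qed
  have D: "D v i = 2 * x i * v i + rh * v (i - 1)" for v i
  proof -
    have "(\<lambda>i. 2 * x i * v i + rh * v (i - 1)) \<in> bcontfun"
      by (rule bcontfun_discreteI) (rule D_bound)
    then show ?thesis
      by (simp add: D_def Bcontfun_inverse)
  qed
  have lin: "bounded_linear D"
  proof (rule bounded_linear_intro)
    show "D (v + w) = D v + D w" for v w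
      by (rule bcontfun_eqI) (simp add: D algebra_simps)
    show "D (t *\<^sub>R v) = t *\<^sub>R D v" for t v
      by (rule bcontfun_eqI) (simp add: D algebra_simps)
    show "norm (D v) \<le> norm v * (2 * B + \<bar>rh\<bar>)" for v
      using D_bound by (intro norm_bound) (simp add: D)
  qed
  have "(F r 0 has_derivative D) (at x)"
    unfolding has_derivative_at
  proof (intro conjI lin)
    have rest: "norm (F r 0 (x + v) - F r 0 x - D v) \<le> norm v * norm v" for v
    proof (rule norm_bound)
      fix i
      have "(F r 0 (x + v) - F r 0 x - D v) i = v i * v i"
        by (simp add: F_apply D r power2_eq_square algebra_simps)
      then show "norm ((F r 0 (x + v) - F r 0 x - D v) i) \<le> norm v * norm v"
        using norm_bounded[of v i] by (simp only: norm_mult) (intro mult_mono; simp)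
    qed
    have "norm (F r 0 (x + v) - F r 0 x - D v) / norm v \<le> norm v" for v
      using rest[of v] by (cases "v = 0") (simp_all add: pos_divide_le_eq)
    then show "(\<lambda>v. norm (F r 0 (x + v) - F r 0 x - D v) / norm v) \<midarrow>0\<rightarrow> 0"
      by (intro tendsto_sandwich[OF _ _ tendsto_const tendsto_norm_zero[OF tendsto_ident_at]]) auto
  qed
  moreover have "\<exists>E. bounded_linear E \<and> D \<circ> E = id \<and> E \<circ> D = id"
  proof (rule bounded_linear_inverse_exists[OF lin])
    fix v :: linf
    define A where "A = M * norm (D v) / (2 * c)"
    have "\<rho> (x i) * \<bar>v i\<bar> \<le> A / (1 - \<theta>)" for i
    proof (rule affine_contraction_bound[where e = "\<lambda>i. \<rho> (x i) * \<bar>v i\<bar>", OF _ pos(4)])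
      have "\<rho> (x i) * \<bar>v i\<bar> \<le> M * norm v" for i
        using weight_bounds(2)[OF xL(1)] norm_bounded[of v i] pos by (intro mult_mono) auto
      then show "bdd_above (range (\<lambda>i. \<rho> (x i) * \<bar>v i\<bar>))"
        by (intro bdd_aboveI) auto
      fix d i assume d: "\<And>i. \<rho> (x i) * \<bar>v i\<bar> \<le> d"
      have "v i = D v i / (2 * x i) - rh * v (i - 1) / (2 * x i)"
        using xL(2)[of i] by (simp add: D field_simps)
      then have "\<bar>v i\<bar> \<le> \<bar>D v i / (2 * x i)\<bar> + \<bar>rh * v (i - 1) / (2 * x i)\<bar>"
        by linarith
      then have "\<bar>v i\<bar> \<le> \<bar>D v i\<bar> / (2 * \<bar>x i\<bar>) + \<bar>rh\<bar> * \<bar>v (i - 1)\<bar> / (2 * \<bar>x i\<bar>)"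
        by (simp add: abs_mult)
      then have "\<rho> (x i) * \<bar>v i\<bar> \<le>
          \<rho> (x i) * (\<bar>D v i\<bar> / (2 * \<bar>x i\<bar>)) + \<rho> (x i) * (\<bar>rh\<bar> * \<bar>v (i - 1)\<bar> / (2 * \<bar>x i\<bar>))"
        unfolding distrib_left[symmetric] using xL(5)[of i] by (intro mult_left_mono) auto
      also have "\<dots> \<le> A + \<theta> * d"
        unfolding A_def using norm_bounded[of "D v" i]
        by (intro add_mono weight_source_bound[OF xL(1) cB(1) xL(3)] orbits_contraction[OF x _ d]) auto
      finally show "\<rho> (x i) * \<bar>v i\<bar> \<le> A + \<theta> * d" .
    qed
    moreover have "m * \<bar>v i\<bar> \<le> \<rho> (x i) * \<bar>v i\<bar>" for i
      using weight_bounds(1)[OF xL(1)] by (intro mult_right_mono) auto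
    ultimately have "m * \<bar>v i\<bar> \<le> A / (1 - \<theta>)" for i
      using order_trans by blast
    then have "\<bar>v i\<bar> \<le> A / (1 - \<theta>) / m" for i
      by (subst pos_le_divide_eq[OF pos(1)]) (simp add: mult.commute)
    then have "norm v \<le> A / (1 - \<theta>) / m"
      by (intro norm_bound) simp
    then show "norm v \<le> M / (2 * c) / (1 - \<theta>) / m * norm (D v)"
      by (simp add: A_def)
  next
    fix w :: linf
    define \<eta> where "\<eta> = M * norm w / (2 * c) / (1 - \<theta>)"
    have "\<exists>v. (\<forall>i. \<rho> (x i) * \<bar>v i\<bar> \<le> \<eta>) \<and> (\<forall>i. (w i - rh * v (i - 1)) / (2 * x i) = v i)"
    proof (rule weighted_fixed_point[OF xL(5), of \<theta>])
      show "0 \<le> \<theta>" "\<theta> < 1" "0 \<le> \<eta>"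
        using pos cB by (auto simp: \<eta>_def)
      have "\<rho> (x i) * (\<bar>w i\<bar> / (2 * \<bar>x i\<bar>)) \<le> M * norm w / (2 * c)" for i
        using norm_bounded[of w i] by (intro weight_source_bound[OF xL(1) cB(1) xL(3)]) simp
      then show "\<rho> (x i) * \<bar>(w i - rh * 0) / (2 * x i)\<bar> \<le> (1 - \<theta>) * \<eta>" for i
        using pos by (simp add: \<eta>_def abs_mult abs_divide)
      fix v v' :: "int \<Rightarrow> real" and d i
      assume "\<And>i. \<rho> (x i) * \<bar>v i - v' i\<bar> \<le> d"
      then have "\<rho> (x i) * (\<bar>rh\<bar> * \<bar>v (i - 1) - v' (i - 1)\<bar> / (2 * \<bar>x i\<bar>)) \<le> \<theta> * d"
        by (intro orbits_contraction[OF x]) auto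
      moreover have "(w i - rh * v (i - 1)) / (2 * x i) - (w i - rh * v' (i - 1)) / (2 * x i) =
          - (rh * (v (i - 1) - v' (i - 1)) / (2 * x i))"
        using xL(2)[of i] by (simp add: field_simps)
      ultimately show "\<rho> (x i) * \<bar>(w i - rh * v (i - 1)) / (2 * x i) - (w i - rh * v' (i - 1)) / (2 * x i)\<bar> \<le> \<theta> * d"
        by (simp add: abs_mult abs_divide)
    qed
    then obtain v where v: "\<And>i. \<rho> (x i) * \<bar>v i\<bar> \<le> \<eta>" "\<And>i. (w i - rh * v (i - 1)) / (2 * x i) = v i"
      by blast
    have "\<bar>v i\<bar> \<le> \<eta> / m" for i
    proof -
      have "m * \<bar>v i\<bar> \<le> \<rho> (x i) * \<bar>v i\<bar>"
        using weight_bounds(1)[OF xL(1)] by (intro mult_right_mono) auto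
      with v(1)[of i] have "m * \<bar>v i\<bar> \<le> \<eta>"
        by linarith
      then show ?thesis
        using pos by (simp add: pos_le_divide_eq mult.commute)
    qed
    then have "v \<in> bcontfun"
      by (rule bcontfun_discreteI)
    then obtain u where u: "v = apply_bcontfun u"
      by (rule bcontfunE)
    have "D u i = w i" for i
      using v(2)[of i] xL(2)[of i] by (simp add: D u[symmetric] field_simps)
    then show "\<exists>v. D v = w"
      by (intro exI[of _ u] bcontfun_eqI) simp
  qed
  moreover have "F r 0 x = 0"
  proof (rule bcontfun_eqI)
    fix i show "F r 0 x i = (0 :: linf) i"
      using orbits_step[OF x, of i] by (simp add: F_apply r)
  qed
  ultimately show ?thesis
    unfolding nondegenerate_zero_def by blast
qed

end

section \<open>Product topology and conjugacy with the shift\<close>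

lemma compact_PiE_UNIV:
  fixes K :: "'b::topological_space set"
  assumes "compact K"
  shows "compact (Pi\<^sub>E UNIV (\<lambda>_::'a. K))"
  using compactin_PiE[of "\<lambda>_::'a. euclidean :: 'b topology" UNIV "\<lambda>_. K"] assms
  by (auto simp: euclidean_product_topology)

lemma closed_Collect_henon_seq:
  fixes f :: "'a::topological_space \<Rightarrow> int \<Rightarrow> real"
  assumes "continuous_on UNIV f"
  shows "closed {z. henon_seq \<epsilon> q (f z)}"
proof -
  have "continuous_on UNIV (\<lambda>z. f z i)" for i
    using assms by (rule continuous_on_product_then_coordinatewise)
  then show ?thesis
    unfolding henon_seq_def by (intro closed_Collect_all closed_Collect_eq continuous_intros)
qed

lemma shift_henon_seq: "henon_seq \<epsilon> q (shift x) \<longleftrightarrow> henon_seq \<epsilon> q x"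
proof
  assume x: "henon_seq \<epsilon> q (shift x)"
  show "henon_seq \<epsilon> q x"
    unfolding henon_seq_def
  proof
    fix i show "\<epsilon> * x (i + 1) - (1 - (x i)\<^sup>2) + q * x (i - 1) = 0"
      using henon_seqD[OF x, of "i - 1"] by (simp add: shift_def)
  qed
next
  assume x: "henon_seq \<epsilon> q x"
  show "henon_seq \<epsilon> q (shift x)"
    unfolding henon_seq_def
  proof
    fix i show "\<epsilon> * shift x (i + 1) - (1 - (shift x i)\<^sup>2) + q * shift x (i - 1) = 0"
      using henon_seqD[OF x, of "i + 1"] by (simp add: shift_def algebra_simps)
  qed
qed

text \<open>Two neighbouring entries determine the rest: the recurrence is solved forwards by
  dividing by \<open>\<epsilon>\<close> and backwards by dividing by \<open>q\<close>. Hence a point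
  of the plane determines its full orbit.\<close>

lemma henon_seq_eqI:
  assumes "\<epsilon> \<noteq> 0" "q \<noteq> 0" and x: "henon_seq \<epsilon> q x" and y: "henon_seq \<epsilon> q y"
    and eq: "x 0 = y 0" "x (- 1) = y (- 1)"
  shows "x = y"
proof
  fix i
  have "x i = y i \<and> x (i - 1) = y (i - 1)"
  proof (induction i rule: int_induct[of _ 0])
    case base
    then show ?case
      using eq by simp
  next
    case (step1 i)
    then have e: "x i = y i" "x (i - 1) = y (i - 1)"
      by auto
    have "\<epsilon> * x (i + 1) = \<epsilon> * y (i + 1)"
      using henon_seqD[OF x, of i] henon_seqD[OF y, of i] unfolding e by linarith
    with e assms(1) show ?case
      by simp
  next
    case (step2 i)
    then have e: "x i = y i" "x (i - 1) = y (i - 1)"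
      by auto
    have "\<epsilon> * x i - (1 - (x (i - 1))\<^sup>2) + q * x (i - 1 - 1) = 0"
      "\<epsilon> * y i - (1 - (y (i - 1))\<^sup>2) + q * y (i - 1 - 1) = 0"
      using henon_seqD[OF x, of "i - 1"] henon_seqD[OF y, of "i - 1"] by simp_all
    then have "q * x (i - 1 - 1) = q * y (i - 1 - 1)"
      unfolding e by linarith
    with e assms(2) show ?case
      by simp
  qed
  then show "x i = y i" ..
qed

text \<open>Solving the recurrence for \<open>x (i + 1)\<close> divides by
  \<open>\<epsilon>\<close>, which produces exactly these parameters. So the map acts as the shift
  on pairs of neighbouring entries.\<close>

lemma henon_henon_seq:
  assumes "0 < \<epsilon>" "henon_seq \<epsilon> q x"
  shows "henon (1 / \<epsilon>\<^sup>2) (q / \<epsilon>) (x i, x (i - 1)) = (x (i + 1), x i)"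
proof -
  have "\<epsilon> * x (i + 1) = 1 - (x i)\<^sup>2 - q * x (i - 1)"
    using henon_seqD[OF assms(2), of i] by linarith
  then have "x (i + 1) = (1 - (x i)\<^sup>2) / \<epsilon> - q * x (i - 1) / \<epsilon>"
    using assms(1) by (simp add: nonzero_eq_divide_eq mult.commute flip: diff_divide_distrib)
  then show ?thesis
    using assms(1) by (simp add: henon_def real_sqrt_divide)
qed

context weighted_repeller
begin

lemma shift_orbits: "shift x \<in> orbits \<longleftrightarrow> x \<in> orbits"
proof -
  have "(\<forall>i. x (i + 1) \<in> Lam) \<longleftrightarrow> (\<forall>i. x i \<in> Lam)"
    by (metis diff_add_cancel)
  then show ?thesis
    by (simp add: orbits_def shift_henon_seq) (simp add: shift_def)
qed

text \<open>Compactness of the graph of the continuation map (in the product topology) replaces a direct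
proof that the continuation depends continuously on the singular orbit.\<close>
lemma continuation_conjugacy:
  fixes h :: "(int \<Rightarrow> real) \<Rightarrow> int \<Rightarrow> real"
  assumes eq: "0 < \<epsilon>" "q \<noteq> 0"
    and h: "\<And>xd. xd \<in> orbits \<Longrightarrow> henon_seq \<epsilon> q (h xd)" "\<And>xd i. xd \<in> orbits \<Longrightarrow> \<bar>h xd i - xd i\<bar> \<le> \<delta>"
    and uniq: "\<And>xd x y. xd \<in> orbits \<Longrightarrow> henon_seq \<epsilon> q x \<Longrightarrow> henon_seq \<epsilon> q y \<Longrightarrow>
      (\<And>i. \<bar>x i - xd i\<bar> \<le> \<delta>) \<Longrightarrow> (\<And>i. \<bar>y i - xd i\<bar> \<le> \<delta>) \<Longrightarrow> x = y"
    and sep: "\<And>x y. x \<in> orbits \<Longrightarrow> y \<in> orbits \<Longrightarrow> (\<And>i. \<bar>x i - y i\<bar> \<le> 2 * \<delta>) \<Longrightarrow> x = y"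
  defines "A \<equiv> (\<lambda>x. (x 0, x (- 1))) ` h ` orbits"
  shows "compact A" "henon (1 / \<epsilon>\<^sup>2) (q / \<epsilon>) ` A = A"
    "topologically_conjugate_on (henon (1 / \<epsilon>\<^sup>2) (q / \<epsilon>)) A shift orbits"
proof -
  let ?H = "henon (1 / \<epsilon>\<^sup>2) (q / \<epsilon>)"
  \<comment> \<open>Defined by closed conditions inside a product of compact sets; uniqueness then
    identifies it with the graph of \<open>h\<close>.\<close>
  define \<Gamma> where "\<Gamma> = {z. fst z \<in> orbits \<and> henon_seq \<epsilon> q (snd z) \<and> (\<forall>i. \<bar>snd z i - fst z i\<bar> \<le> \<delta>)}"
  define g where "g z = (snd z 0, snd z (- 1))" for z :: "(int \<Rightarrow> real) \<times> (int \<Rightarrow> real)"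
  have \<Gamma>: "\<Gamma> = (\<lambda>xd. (xd, h xd)) ` orbits"
  proof (intro equalityI subsetI)
    fix z assume z: "z \<in> \<Gamma>"
    then have "snd z = h (fst z)"
      by (intro uniq[of "fst z"] h) (auto simp: \<Gamma>_def)
    with z show "z \<in> (\<lambda>xd. (xd, h xd)) ` orbits"
      by (auto simp: \<Gamma>_def intro!: image_eqI[of _ _ "fst z"] prod_eqI)
  qed (auto simp: \<Gamma>_def h)
  have cont: "continuous_on S (\<lambda>z. fst z i)" "continuous_on S (\<lambda>z. snd z i)"
    for S :: "((int \<Rightarrow> real) \<times> (int \<Rightarrow> real)) set" and i
    by (rule continuous_on_product_then_coordinatewise[OF continuous_on_fst[OF continuous_on_id]]
        continuous_on_product_then_coordinatewise[OF continuous_on_snd[OF continuous_on_id]])+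
  obtain B where B: "\<And>x. x \<in> Lam \<Longrightarrow> \<bar>x\<bar> \<le> B"
    by (rule Lam_bounds) blast
  have "\<Gamma> \<subseteq> Pi\<^sub>E UNIV (\<lambda>_. Lam) \<times> Pi\<^sub>E UNIV (\<lambda>_. cball (0::real) (B + \<delta>))"
  proof
    fix z assume z: "z \<in> \<Gamma>"
    then have L: "fst z i \<in> Lam" and d: "\<bar>snd z i - fst z i\<bar> \<le> \<delta>" for i
      by (auto simp: \<Gamma>_def orbits_def)
    have "\<bar>snd z i\<bar> \<le> B + \<delta>" for i
      using B[OF L[of i]] d[of i] by linarith
    with L show "z \<in> Pi\<^sub>E UNIV (\<lambda>_. Lam) \<times> Pi\<^sub>E UNIV (\<lambda>_. cball (0::real) (B + \<delta>))"
      by (auto simp: mem_Times_iff)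
  qed
  moreover have "compact (Pi\<^sub>E UNIV (\<lambda>_::int. Lam) \<times> Pi\<^sub>E UNIV (\<lambda>_::int. cball (0::real) (B + \<delta>)))"
    by (intro compact_Times compact_PiE_UNIV compact_Lam compact_cball)
  moreover have "closed \<Gamma>"
  proof -
    have "closed {z :: (int \<Rightarrow> real) \<times> (int \<Rightarrow> real). fst z i \<in> Lam}" for i
    proof -
      have "closed ((\<lambda>z :: (int \<Rightarrow> real) \<times> (int \<Rightarrow> real). fst z i) -` Lam)"
        by (intro closed_vimage compact_imp_closed[OF compact_Lam] cont)
      then show ?thesis
        by (simp add: vimage_def)
    qed
    then show ?thesis
      unfolding \<Gamma>_def orbits_def mem_Collect_eq
      by (intro closed_Collect_conj closed_Collect_henon_seq closed_Collect_all closed_Collect_le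
          continuous_on_rabs continuous_on_diff continuous_on_const cont continuous_on_fst
          continuous_on_snd continuous_on_id)
  qed
  ultimately have c\<Gamma>: "compact \<Gamma>"
    using compact_Int_closed by (metis inf.absorb_iff2)
  have cg: "continuous_on \<Gamma> g"
    unfolding g_def by (intro continuous_on_Pair cont)
  have gA: "g ` \<Gamma> = A"
    unfolding \<Gamma> A_def g_def by (auto simp: image_image)
  have f\<Gamma>: "fst ` \<Gamma> = orbits"
    unfolding \<Gamma> by (auto simp: image_image)
  have "inj_on fst \<Gamma>"
    unfolding \<Gamma> by (auto simp: inj_on_def)
  then obtain k1 where k1: "homeomorphism \<Gamma> orbits fst k1"
    using homeomorphism_compact[OF c\<Gamma> _ f\<Gamma>] continuous_on_fst[OF continuous_on_id] by blast
  \<comment> \<open>A point of the plane fixes the continued orbit; two singular orbits within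
    \<open>\<delta>\<close> of it are within \<open>2 * \<delta>\<close> of each other, hence equal
    by \<open>sep\<close>. So both \<open>fst\<close> and \<open>g\<close> are injective on the
    compact graph, and the conjugacy passes through it.\<close>
  have "inj_on g \<Gamma>"
  proof (rule inj_onI)
    fix z z' assume z: "z \<in> \<Gamma>" and z': "z' \<in> \<Gamma>" and "g z = g z'"
    then have s: "snd z = snd z'"
      using eq by (intro henon_seq_eqI[of \<epsilon> q]) (auto simp: \<Gamma>_def g_def)
    have "\<bar>fst z i - fst z' i\<bar> \<le> 2 * \<delta>" for i
    proof -
      have "\<bar>snd z i - fst z i\<bar> \<le> \<delta>" "\<bar>snd z i - fst z' i\<bar> \<le> \<delta>"
        using z z' by (auto simp: \<Gamma>_def s)
      then show ?thesis
        by linarith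
    qed
    then have "fst z = fst z'"
      using z z' by (intro sep) (auto simp: \<Gamma>_def)
    with s show "z = z'"
      by (simp add: prod_eq_iff)
  qed
  then obtain k2 where k2: "homeomorphism \<Gamma> A g k2"
    using homeomorphism_compact[OF c\<Gamma> cg gA] by blast
  show "compact A"
    using compact_continuous_image[OF cg c\<Gamma>] gA by simp
  have H: "?H (g (xd, h xd)) = g (shift xd, h (shift xd))" and sh: "shift xd \<in> orbits"
    if xd: "xd \<in> orbits" for xd
  proof -
    show s: "shift xd \<in> orbits"
      using xd by (simp add: shift_orbits)
    \<comment> \<open>Both are solutions within \<open>\<delta>\<close> of
      \<open>shift xd\<close>.\<close>
    have "h (shift xd) = shift (h xd)"
      using h[OF s] h(1)[OF xd] h(2)[OF xd]
      by (intro uniq[OF s]) (simp_all add: shift_henon_seq, simp_all add: shift_def)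
    then show "?H (g (xd, h xd)) = g (shift xd, h (shift xd))"
      using henon_henon_seq[OF eq(1) h(1)[OF xd], of 0] by (simp add: g_def shift_def)
  qed
  have A: "A = (\<lambda>xd. g (xd, h xd)) ` orbits"
    unfolding gA[symmetric] \<Gamma> image_image ..
  show HA: "?H ` A = A"
  proof (intro equalityI subsetI)
    fix p assume "p \<in> ?H ` A"
    then show "p \<in> A"
      unfolding A using H sh by auto
  next
    fix p assume "p \<in> A"
    then obtain xd where xd: "xd \<in> orbits" "p = g (xd, h xd)"
      unfolding A by auto
    define yd where "yd = (\<lambda>i. xd (i - 1))"
    have yd: "shift yd = xd"
      by (simp add: yd_def shift_def)
    then have "yd \<in> orbits"
      using xd shift_orbits[of yd] by simp
    with H[of yd] yd xd show "p \<in> ?H ` A"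
      unfolding A by force
  qed
  have "homeomorphism A orbits (fst \<circ> k2) (g \<circ> k1)"
    by (rule homeomorphism_compose[OF homeomorphism_symD[OF k2] k1])
  moreover have "(fst \<circ> k2) (?H p) = shift ((fst \<circ> k2) p)" if p: "p \<in> A" for p
  proof -
    have k2g: "k2 (g (xd, h xd)) = (xd, h xd)" if "xd \<in> orbits" for xd
      using homeomorphism_apply1[OF k2] that unfolding \<Gamma> by blast
    obtain xd where xd: "xd \<in> orbits" "p = g (xd, h xd)"
      using p unfolding A by auto
    show ?thesis
      unfolding xd(2) H[OF xd(1)] by (simp add: k2g xd(1) sh)
  qed
  ultimately show "topologically_conjugate_on ?H A shift orbits"
    unfolding topologically_conjugate_on_def using HA shift_orbits
    by (intro conjI exI[of _ "fst \<circ> k2"] exI[of _ "g \<circ> k1"]) auto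
qed

end

subsection \<open>Singular orbits of the Henon family\<close>

text \<open>For \<open>rh = 0\<close> the coupling disappears: the left side of the contraction
  inequality is 0, so a constant weight will do, and 1/2 is an arbitrary rate.\<close>

lemma weighted_repeller_zero: "weighted_repeller {- 1, 1} 0 (\<lambda>_. 1) 1 1 (1 / 2)"
  by unfold_locales auto

text \<open>Since \<open>sqrt a = 1 / \<bar>rh\<bar>\<close>, the relation
  \<open>rh * y = 1 - x\<^sup>2\<close> means \<open>quad a x = \<sigma> * y\<close> with
  \<open>\<sigma>\<close> the sign of \<open>rh\<close>. Evaluating the weight at
  \<open>\<sigma> * x\<close> absorbs the sign, as the repeller is symmetric.\<close>

lemma weighted_repeller_quad:
  assumes rh: "rh \<noteq> 0" and hyp: "quad_hyperbolic (1 / rh\<^sup>2)"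
  obtains \<rho> m M \<theta> where "weighted_repeller (quad_repeller (1 / rh\<^sup>2)) rh \<rho> m M \<theta>"
proof -
  define a where "a = 1 / rh\<^sup>2"
  define L where "L = quad_repeller a"
  define \<sigma> where "\<sigma> = sgn rh"
  have a: "0 < a"
    using rh by (simp add: a_def)
  have sa: "sqrt a = 1 / \<bar>rh\<bar>"
    by (simp add: a_def real_sqrt_divide)
  have hypa: "quad_hyperbolic a"
    using hyp by (simp add: a_def)
  have cL: "compact L"
    unfolding L_def by (rule compact_quad_repeller[OF a])
  have disj: "L \<inter> closure (forward_orbit (quad a) 0) = {}"
    unfolding L_def by (rule quad_repeller_critical_orbit[OF a hypa])
  have bd: "bounded (forward_orbit (quad a) x)" if "x \<in> L" for x
    using that by (auto simp: L_def quad_repeller_def split: if_splits)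
  have \<sigma>: "\<bar>\<sigma>\<bar> = 1" "\<sigma> * \<bar>rh\<bar> = rh" "\<sigma> = 1 \<or> \<sigma> = - 1"
    using rh by (auto simp: \<sigma>_def sgn_real_def)
  \<comment> \<open>\<open>x\<close> and \<open>- x\<close> have the same image, and the image
    decides membership.\<close>
  have sym: "\<sigma> * x \<in> L \<longleftrightarrow> x \<in> L" for x
    using \<sigma>(3) quad_repeller_step[of a "- x"] quad_repeller_step[of a x] by (auto simp: L_def)
  obtain \<rho> m M \<theta> where w: "0 < m" "0 < \<theta>" "\<theta> < 1" "\<And>x. x \<in> L \<Longrightarrow> m \<le> \<rho> x"
    "\<And>x. x \<in> L \<Longrightarrow> \<rho> x \<le> M"
    "\<And>x. x \<in> L \<Longrightarrow> quad a x \<in> L \<Longrightarrow> \<rho> x \<le> \<theta> * (2 * sqrt a * \<bar>x\<bar>) * \<rho> (quad a x)"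
    by (rule quad_expanding[OF a cL disj bd]) (assumption | blast)+
  have "weighted_repeller L rh (\<lambda>x. \<rho> (\<sigma> * x)) m (max M 1) \<theta>"
  proof
    show "compact L"
      by (rule cL)
    show "0 \<notin> L"
      using disj forward_orbit_self[of 0 "quad a"] closure_subset by blast
    show "0 < m" "0 < max M 1" "0 < \<theta>" "\<theta> < 1"
      using w by auto
    show "m \<le> \<rho> (\<sigma> * x)" "\<rho> (\<sigma> * x) \<le> max M 1" if "x \<in> L" for x
      using w(4,5)[of "\<sigma> * x"] that by (auto simp: sym)
    fix x y assume x: "x \<in> L" and y: "y \<in> L" and xy: "rh * y = 1 - x\<^sup>2"
    have "quad a (\<sigma> * x) = (1 - x\<^sup>2) / \<bar>rh\<bar>"
      using \<sigma>(3) by (auto simp: quad_def sa)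
    also have "\<dots> = \<sigma> * y"
      unfolding xy[symmetric] using rh \<sigma>(2) by (simp add: field_simps)
    finally have q: "quad a (\<sigma> * x) = \<sigma> * y" .
    have "\<rho> (\<sigma> * x) \<le> \<theta> * (2 * sqrt a * \<bar>\<sigma> * x\<bar>) * \<rho> (quad a (\<sigma> * x))"
      using x y by (intro w(6)) (auto simp: q sym)
    then have "\<rho> (\<sigma> * x) \<le> \<theta> * (2 / \<bar>rh\<bar> * \<bar>x\<bar>) * \<rho> (\<sigma> * y)"
      by (simp add: q sa abs_mult \<sigma>(1))
    then have "\<bar>rh\<bar> * \<rho> (\<sigma> * x) \<le> \<bar>rh\<bar> * (\<theta> * (2 / \<bar>rh\<bar> * \<bar>x\<bar>) * \<rho> (\<sigma> * y))"
      by (intro mult_left_mono) auto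
    also have "\<dots> = \<theta> * (2 * \<bar>x\<bar>) * \<rho> (\<sigma> * y)"
      using rh by simp
    finally show "\<bar>rh\<bar> * \<rho> (\<sigma> * x) \<le> \<theta> * (2 * \<bar>x\<bar>) * \<rho> (\<sigma> * y)" .
  qed
  then show ?thesis
    using that by (simp add: L_def a_def)
qed

lemma Lambda_set_ereal: "Lambda_set (ereal a) = quad_repeller a"
  by (simp add: Lambda_set_def)

lemma weighted_repeller_Hyp:
  assumes "1 / (ereal rh)\<^sup>2 \<in> Hyp"
  obtains \<rho> m M \<theta> where "weighted_repeller (Lambda_set (1 / (ereal rh)\<^sup>2)) rh \<rho> m M \<theta>"
proof (cases "rh = 0")
  case True
  then have "1 / (ereal rh)\<^sup>2 = \<infinity>"
    by (simp add: power2_eq_square flip: zero_ereal_def)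
  then have "Lambda_set (1 / (ereal rh)\<^sup>2) = {- 1, 1}"
    by (simp add: Lambda_set_def)
  then show ?thesis
    using that weighted_repeller_zero True by simp
next
  case False
  then have eq: "1 / (ereal rh)\<^sup>2 = ereal (1 / rh\<^sup>2)"
    by (simp add: power2_eq_square one_ereal_def)
  then have "quad_hyperbolic (1 / rh\<^sup>2)"
    using assms by (auto simp: Hyp_def)
  then show ?thesis
    by (rule weighted_repeller_quad[OF False]) (rule that, unfold eq Lambda_set_ereal)
qed

section \<open>Transfer to bounded sequences and Hausdorff convergence\<close>

lemma mem_zeros_iff: "x \<in> zeros r \<epsilon> \<longleftrightarrow> henon_seq \<epsilon> (r \<epsilon>) (apply_bcontfun x)"
proof -
  have "F r \<epsilon> x = 0 \<longleftrightarrow> (\<forall>i. F r \<epsilon> x i = 0)"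
    by (metis bcontfun_eqI zero_bcontfun.rep_eq)
  then show ?thesis
    by (simp add: zeros_def henon_seq_def F_apply)
qed

lemma hausdorff_distance_nonneg: "0 \<le> hausdorff_distance S T"
  unfolding hausdorff_distance_def by (rule Inf_greatest) auto

lemma hausdorff_distance_image_le:
  fixes f g :: "'a \<Rightarrow> 'b::metric_space"
  assumes "0 < \<eta>" "\<And>x. x \<in> X \<Longrightarrow> dist (f x) (g x) < \<eta>"
  shows "hausdorff_distance (f ` X) (g ` X) \<le> ereal \<eta>"
  unfolding hausdorff_distance_def
proof (rule Inf_lower, intro CollectI exI conjI)
  show "f ` X \<subseteq> (\<Union>t\<in>g ` X. ball t \<eta>)" "g ` X \<subseteq> (\<Union>s\<in>f ` X. ball s \<eta>)"
    using assms(2) by (auto simp: dist_commute)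
qed (use assms(1) in auto)

theorem theorem6:
  fixes r :: "real \<Rightarrow> real" and ebar rhat :: real
  assumes "0 < ebar"
    and "\<exists>r'. continuous_on {0..<ebar} r' \<and>
              (\<forall>t\<in>{0..<ebar}. (r has_real_derivative r' t) (at t within {0..<ebar}))"
    and "\<forall>t\<in>{0<..<ebar}. r t \<noteq> 0"
    and "(r \<longlongrightarrow> rhat) (at_right 0)" and "r 0 = rhat"
    and "1 / (ereal rhat)\<^sup>2 \<in> Hyp"
  shows
    "(\<forall>xd\<in>zeros0 r.
        nondegenerate_zero (F r 0) xd \<and>
        (\<exists>\<epsilon>0 \<delta>0. 0 < \<epsilon>0 \<and> \<epsilon>0 \<le> ebar \<and> 0 < \<delta>0 \<and>
           (\<forall>\<epsilon>\<in>{0..<\<epsilon>0}. \<exists>!x. x \<in> zeros r \<epsilon> \<and> (\<forall>i. \<bar>x i - xd i\<bar> < \<delta>0)))) \<and>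
     (\<exists>\<epsilon>0 \<delta>0. 0 < \<epsilon>0 \<and> \<epsilon>0 \<le> ebar \<and> 0 < \<delta>0 \<and>
        (\<forall>xd\<in>zeros0 r. \<forall>\<epsilon>\<in>{0..<\<epsilon>0}.
           \<exists>!x. x \<in> zeros r \<epsilon> \<and> (\<forall>i. \<bar>x i - xd i\<bar> < \<delta>0)) \<and>
        (\<forall>\<epsilon>\<in>{0<..<\<epsilon>0}.
           compact (A_set r \<delta>0 \<epsilon>) \<and>
           henon (1 / \<epsilon>\<^sup>2) (r \<epsilon> / \<epsilon>) ` A_set r \<delta>0 \<epsilon> = A_set r \<delta>0 \<epsilon> \<and>
           topologically_conjugate_on
             (henon (1 / \<epsilon>\<^sup>2) (r \<epsilon> / \<epsilon>)) (A_set r \<delta>0 \<epsilon>)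
             shift (apply_bcontfun ` zeros0 r)) \<and>
        (\<forall>xd\<in>zeros0 r. \<forall>i. ((\<lambda>\<epsilon>. continuation r \<delta>0 \<epsilon> xd i) \<longlongrightarrow> xd i) (at_right 0)) \<and>
        ((\<lambda>\<epsilon>. hausdorff_distance (A_set r \<delta>0 \<epsilon>) (A0_set r)) \<longlongrightarrow> 0) (at_right 0))"
proof -
  define Lam where "Lam = Lambda_set (1 / (ereal rhat)\<^sup>2)"
  obtain \<rho> m M \<theta> where "weighted_repeller Lam rhat \<rho> m M \<theta>"
    unfolding Lam_def by (rule weighted_repeller_Hyp[OF assms(6)])
  then interpret weighted_repeller Lam rhat \<rho> m M \<theta> .
  have r0: "r 0 = rhat"
    by (rule assms(5))
  have zeros0_iff: "x \<in> zeros0 r \<longleftrightarrow> apply_bcontfun x \<in> orbits" for x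
    using mem_zeros_iff[of x r 0]
    unfolding zeros0_def zeros_def orbits_def r0 Lam_def[symmetric] by simp
  obtain c B where B: "\<And>x. x \<in> Lam \<Longrightarrow> \<bar>x\<bar> \<le> B"
    by (rule Lam_bounds) blast
  \<comment> \<open>Singular orbits take values in the compact \<open>Lam\<close>, so every one of
    them is a bounded sequence.\<close>
  have zeros0_image: "apply_bcontfun ` zeros0 r = orbits"
  proof (intro equalityI subsetI)
    fix x assume x: "x \<in> orbits"
    then have "x \<in> bcontfun"
      using B by (intro bcontfun_discreteI[of _ B]) (auto simp: orbits_def)
    then obtain y where "x = apply_bcontfun y"
      by (rule bcontfunE)
    with x show "x \<in> apply_bcontfun ` zeros0 r"
      by (auto simp: zeros0_iff)
  qed (auto simp: zeros0_iff)
  obtain s0 \<delta> C where s0: "0 < s0" and \<delta>: "0 < \<delta>" and C: "0 \<le> C"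
    and ex: "\<And>xd \<epsilon> q. xd \<in> orbits \<Longrightarrow> \<bar>\<epsilon>\<bar> + \<bar>q - rhat\<bar> \<le> s0 \<Longrightarrow>
      C * (\<bar>\<epsilon>\<bar> + \<bar>q - rhat\<bar>) < \<delta> \<and>
      (\<exists>x. henon_seq \<epsilon> q x \<and> (\<forall>i. \<bar>x i - xd i\<bar> \<le> C * (\<bar>\<epsilon>\<bar> + \<bar>q - rhat\<bar>)))"
    and uniq: "\<And>xd \<epsilon> q x y. xd \<in> orbits \<Longrightarrow> \<bar>\<epsilon>\<bar> + \<bar>q - rhat\<bar> \<le> s0 \<Longrightarrow> henon_seq \<epsilon> q x \<Longrightarrow>
      henon_seq \<epsilon> q y \<Longrightarrow> (\<And>i. \<bar>x i - xd i\<bar> \<le> 2 * \<delta>) \<Longrightarrow> (\<And>i. \<bar>y i - xd i\<bar> \<le> 2 * \<delta>) \<Longrightarrow> x = y"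
    by (rule perturbation) blast
  define s where "s \<epsilon> = \<bar>\<epsilon>\<bar> + \<bar>r \<epsilon> - rhat\<bar>" for \<epsilon>
  have s_lim: "(s \<longlongrightarrow> 0) (at_right 0)"
  proof -
    have "((\<lambda>\<epsilon>. \<bar>\<epsilon>\<bar> + \<bar>r \<epsilon> - rhat\<bar>) \<longlongrightarrow> \<bar>0\<bar> + \<bar>rhat - rhat\<bar>) (at_right 0)"
      by (intro tendsto_intros assms(4))
    then show ?thesis
      by (simp add: s_def[abs_def])
  qed
  then have "\<forall>\<^sub>F \<epsilon> in at_right 0. s \<epsilon> < s0"
    using s0 by (rule order_tendstoD)
  then obtain b where b: "0 < b" "\<And>\<epsilon>. 0 < \<epsilon> \<Longrightarrow> \<epsilon> < b \<Longrightarrow> s \<epsilon> < s0"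
    unfolding eventually_at_right_field by auto
  define \<epsilon>0 where "\<epsilon>0 = min b ebar"
  have \<epsilon>0: "0 < \<epsilon>0" "\<epsilon>0 \<le> ebar"
    using b assms(1) by (auto simp: \<epsilon>0_def)
  \<comment> \<open>The right-hand limit is silent at \<open>\<epsilon> = 0\<close>; there
    \<open>s 0 = 0\<close> because \<open>r 0 = rhat\<close>.\<close>
  have s_le: "s \<epsilon> \<le> s0" if "\<epsilon> \<in> {0..<\<epsilon>0}" for \<epsilon>
    using that b(2)[of \<epsilon>] s0 by (cases "\<epsilon> = 0") (auto simp: \<epsilon>0_def s_def r0)
  have ex1: "\<exists>!x. x \<in> zeros r \<epsilon> \<and> (\<forall>i. \<bar>x i - xd i\<bar> < \<delta>)"
    and close: "\<And>i. \<bar>continuation r \<delta> \<epsilon> xd i - xd i\<bar> \<le> C * s \<epsilon>"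
    and cont_zero: "henon_seq \<epsilon> (r \<epsilon>) (continuation r \<delta> \<epsilon> xd)"
    and Cs: "C * s \<epsilon> < \<delta>"
    if xd: "xd \<in> zeros0 r" and \<epsilon>: "\<epsilon> \<in> {0..<\<epsilon>0}" for xd \<epsilon>
  proof -
    have o: "apply_bcontfun xd \<in> orbits"
      using xd by (simp add: zeros0_iff)
    note sl = s_le[OF \<epsilon>, unfolded s_def]
    obtain x where x: "henon_seq \<epsilon> (r \<epsilon>) x" "\<And>i. \<bar>x i - xd i\<bar> \<le> C * s \<epsilon>"
      and Cs': "C * s \<epsilon> < \<delta>"
      using ex[OF o sl] unfolding s_def by blast
    show "C * s \<epsilon> < \<delta>"
      by (rule Cs')
    have "\<bar>x i\<bar> \<le> norm xd + \<delta>" for i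
      using x(2)[of i] norm_bounded[of xd i] Cs' unfolding real_norm_def by linarith
    then have "x \<in> bcontfun"
      by (rule bcontfun_discreteI)
    then obtain y where y: "x = apply_bcontfun y"
      by (rule bcontfunE)
    have yP: "y \<in> zeros r \<epsilon> \<and> (\<forall>i. \<bar>y i - xd i\<bar> < \<delta>)"
      using x Cs' unfolding y by (auto simp: mem_zeros_iff intro: le_less_trans)
    have yU: "z = y" if z: "z \<in> zeros r \<epsilon> \<and> (\<forall>i. \<bar>z i - xd i\<bar> < \<delta>)" for z
    proof -
      have le: "\<bar>w i - xd i\<bar> \<le> 2 * \<delta>" if "\<forall>i. \<bar>w i - xd i\<bar> < \<delta>" for w :: linf and i
        using that[rule_format, of i] \<delta> by linarith
      have "apply_bcontfun z = apply_bcontfun y"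
        using z yP le by (intro uniq[OF o sl]) (simp_all add: mem_zeros_iff)
      then show ?thesis
        by (simp add: apply_bcontfun_inject)
    qed
    show "\<exists>!x. x \<in> zeros r \<epsilon> \<and> (\<forall>i. \<bar>x i - xd i\<bar> < \<delta>)"
      using yP yU by blast
    have "continuation r \<delta> \<epsilon> xd = y"
      unfolding continuation_def using yP yU by (rule the_equality)
    then show "\<And>i. \<bar>continuation r \<delta> \<epsilon> xd i - xd i\<bar> \<le> C * s \<epsilon>"
      "henon_seq \<epsilon> (r \<epsilon>) (continuation r \<delta> \<epsilon> xd)"
      using x y by auto
  qed
  have dynamics: "compact (A_set r \<delta> \<epsilon>) \<and>
      henon (1 / \<epsilon>\<^sup>2) (r \<epsilon> / \<epsilon>) ` A_set r \<delta> \<epsilon> = A_set r \<delta> \<epsilon> \<and>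
      topologically_conjugate_on (henon (1 / \<epsilon>\<^sup>2) (r \<epsilon> / \<epsilon>)) (A_set r \<delta> \<epsilon>) shift (apply_bcontfun ` zeros0 r)"
    if \<epsilon>: "\<epsilon> \<in> {0<..<\<epsilon>0}" for \<epsilon>
  proof -
    have \<epsilon>': "0 < \<epsilon>" "\<epsilon> \<in> {0..<\<epsilon>0}"
      using \<epsilon> by auto
    have q: "r \<epsilon> \<noteq> 0"
      using assms(3) \<epsilon> \<epsilon>0(2) by auto
    \<comment> \<open>The conjugacy lemma works on plain functions; \<open>Bcontfun\<close> turns an
      orbit into the bounded sequence that \<open>continuation\<close> takes.\<close>
    define h where "h x = apply_bcontfun (continuation r \<delta> \<epsilon> (Bcontfun x))" for x
    have h_apply: "h (apply_bcontfun x) = apply_bcontfun (continuation r \<delta> \<epsilon> x)" for x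
      by (simp add: h_def apply_bcontfun_inverse)
    have h1: "henon_seq \<epsilon> (r \<epsilon>) (h x)" and h2: "\<bar>h x i - x i\<bar> \<le> \<delta>" if x: "x \<in> orbits" for x i
    proof -
      obtain y where y: "y \<in> zeros0 r" "x = apply_bcontfun y"
        using x unfolding zeros0_image[symmetric] by blast
      show "henon_seq \<epsilon> (r \<epsilon>) (h x)" "\<bar>h x i - x i\<bar> \<le> \<delta>"
        using cont_zero[OF y(1) \<epsilon>'(2)] close[OF y(1) \<epsilon>'(2), of i] Cs[OF y(1) \<epsilon>'(2)]
        unfolding y(2) h_apply by auto
    qed
    have u1: "x = y" if "xd \<in> orbits" "henon_seq \<epsilon> (r \<epsilon>) x" "henon_seq \<epsilon> (r \<epsilon>) y"
      "\<And>i. \<bar>x i - xd i\<bar> \<le> \<delta>" "\<And>i. \<bar>y i - xd i\<bar> \<le> \<delta>" for xd x y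
    proof (rule uniq[OF that(1) s_le[OF \<epsilon>'(2), unfolded s_def] that(2,3)])
      show "\<bar>x i - xd i\<bar> \<le> 2 * \<delta>" "\<bar>y i - xd i\<bar> \<le> 2 * \<delta>" for i
        using that(4)[of i] that(5)[of i] \<delta> by auto
    qed
    \<comment> \<open>Uniqueness at \<open>\<epsilon> = 0\<close>, \<open>q = rhat\<close> around
      the centre \<open>y\<close>: both \<open>x\<close> and \<open>y\<close> are solutions within
      \<open>2 * \<delta>\<close> of it.\<close>
    have u2: "x = y" if "x \<in> orbits" "y \<in> orbits" "\<And>i. \<bar>x i - y i\<bar> \<le> 2 * \<delta>" for x y
    proof (rule uniq[OF that(2), of 0 rhat])
      show "henon_seq 0 rhat x" "henon_seq 0 rhat y"
        using that by (auto simp: orbits_def)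
    qed (use that s0 \<delta> in auto)
    have A: "A_set r \<delta> \<epsilon> = (\<lambda>x. (x 0, x (- 1))) ` h ` orbits"
      unfolding A_set_def zeros0_image[symmetric] image_image h_apply ..
    show ?thesis
      unfolding A zeros0_image
      by (intro conjI; rule continuation_conjugacy[where h = h and \<delta> = \<delta>, OF \<epsilon>'(1) q];
          fact h1 h2 u1 u2)
  qed
  have ev: "\<forall>\<^sub>F \<epsilon> in at_right 0. \<epsilon> \<in> {0<..<\<epsilon>0}"
    using \<epsilon>0(1) by (auto simp: eventually_at_right_field)
  have pointwise: "((\<lambda>\<epsilon>. continuation r \<delta> \<epsilon> xd i) \<longlongrightarrow> xd i) (at_right 0)" if xd: "xd \<in> zeros0 r" for xd i
  proof -
    have lim: "((\<lambda>\<epsilon>. C * s \<epsilon>) \<longlongrightarrow> 0) (at_right 0)"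
      by (rule tendsto_mult_right_zero[OF s_lim])
    have "((\<lambda>\<epsilon>. continuation r \<delta> \<epsilon> xd i - xd i) \<longlongrightarrow> 0) (at_right 0)"
    proof (rule Lim_null_comparison[OF _ lim])
      show "\<forall>\<^sub>F \<epsilon> in at_right 0. norm (continuation r \<delta> \<epsilon> xd i - xd i) \<le> C * s \<epsilon>"
        using ev
      proof eventually_elim
        case (elim \<epsilon>)
        then have "\<epsilon> \<in> {0..<\<epsilon>0}"
          by auto
        from close[OF xd this, of i] show ?case
          by simp
      qed
    qed
    then show ?thesis
      by (simp add: LIM_zero_iff)
  qed
  have hausdorff: "((\<lambda>\<epsilon>. hausdorff_distance (A_set r \<delta> \<epsilon>) (A0_set r)) \<longlongrightarrow> 0) (at_right 0)"
  proof (rule tendsto_sandwich[OF _ _ tendsto_const])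
    show "\<forall>\<^sub>F \<epsilon> in at_right 0. 0 \<le> hausdorff_distance (A_set r \<delta> \<epsilon>) (A0_set r)"
      by (simp add: hausdorff_distance_nonneg)
    \<comment> \<open>The factor 2 counts the two coordinates; the extra \<open>\<epsilon>\<close>
      makes the radius positive and the inequality strict even if
      \<open>C * s \<epsilon> = 0\<close>.\<close>
    show "\<forall>\<^sub>F \<epsilon> in at_right 0. hausdorff_distance (A_set r \<delta> \<epsilon>) (A0_set r) \<le> ereal (2 * (C * s \<epsilon>) + \<epsilon>)"
      using ev
    proof eventually_elim
      case (elim \<epsilon>)
      then have \<epsilon>: "0 < \<epsilon>" "\<epsilon> \<in> {0..<\<epsilon>0}"
        by auto
      have "0 \<le> C * s \<epsilon>"
        using C by (simp add: s_def)
      then have "0 < 2 * (C * s \<epsilon>) + \<epsilon>"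
        using \<epsilon> by linarith
      then show ?case
        unfolding A_set_def A0_set_def image_image
      proof (rule hausdorff_distance_image_le)
        fix xd assume xd: "xd \<in> zeros0 r"
        let ?x = "continuation r \<delta> \<epsilon> xd"
        have "dist (?x 0, ?x (- 1)) (xd 0, xd (- 1)) \<le> \<bar>?x 0 - xd 0\<bar> + \<bar>?x (- 1) - xd (- 1)\<bar>"
          unfolding dist_Pair_Pair dist_real_def by (rule sqrt_sum_squares_le_sum_abs[THEN order_trans]) simp
        also have "\<dots> < 2 * (C * s \<epsilon>) + \<epsilon>"
          using close[OF xd \<epsilon>(2), of 0] close[OF xd \<epsilon>(2), of "- 1"] \<epsilon>(1) by linarith
        finally show "dist (?x 0, ?x (- 1)) (xd 0, xd (- 1)) < 2 * (C * s \<epsilon>) + \<epsilon>" .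
      qed
    qed
    have "((\<lambda>\<epsilon>. 2 * (C * s \<epsilon>) + \<epsilon>) \<longlongrightarrow> 2 * (C * 0) + 0) (at_right 0)"
      by (intro tendsto_intros s_lim)
    then show "((\<lambda>\<epsilon>. ereal (2 * (C * s \<epsilon>) + \<epsilon>)) \<longlongrightarrow> 0) (at_right 0)"
      by (simp add: zero_ereal_def)
  qed
  have nondeg: "nondegenerate_zero (F r 0) xd" if "xd \<in> zeros0 r" for xd
    using that by (intro nondegenerate r0) (simp add: zeros0_iff)
  show ?thesis
  proof (intro conjI ballI)
    fix xd assume xd: "xd \<in> zeros0 r"
    show "nondegenerate_zero (F r 0) xd"
      by (rule nondeg[OF xd])
    show "\<exists>\<epsilon>0 \<delta>0. 0 < \<epsilon>0 \<and> \<epsilon>0 \<le> ebar \<and> 0 < \<delta>0 \<and>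
        (\<forall>\<epsilon>\<in>{0..<\<epsilon>0}. \<exists>!x. x \<in> zeros r \<epsilon> \<and> (\<forall>i. \<bar>x i - xd i\<bar> < \<delta>0))"
      using \<epsilon>0 \<delta> ex1[OF xd] by blast
  next
    show "\<exists>\<epsilon>0 \<delta>0. 0 < \<epsilon>0 \<and> \<epsilon>0 \<le> ebar \<and> 0 < \<delta>0 \<and>
        (\<forall>xd\<in>zeros0 r. \<forall>\<epsilon>\<in>{0..<\<epsilon>0}.
           \<exists>!x. x \<in> zeros r \<epsilon> \<and> (\<forall>i. \<bar>x i - xd i\<bar> < \<delta>0)) \<and>
        (\<forall>\<epsilon>\<in>{0<..<\<epsilon>0}.
           compact (A_set r \<delta>0 \<epsilon>) \<and>
           henon (1 / \<epsilon>\<^sup>2) (r \<epsilon> / \<epsilon>) ` A_set r \<delta>0 \<epsilon> = A_set r \<delta>0 \<epsilon> \<and>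
           topologically_conjugate_on
             (henon (1 / \<epsilon>\<^sup>2) (r \<epsilon> / \<epsilon>)) (A_set r \<delta>0 \<epsilon>)
             shift (apply_bcontfun ` zeros0 r)) \<and>
        (\<forall>xd\<in>zeros0 r. \<forall>i. ((\<lambda>\<epsilon>. continuation r \<delta>0 \<epsilon> xd i) \<longlongrightarrow> xd i) (at_right 0)) \<and>
        ((\<lambda>\<epsilon>. hausdorff_distance (A_set r \<delta>0 \<epsilon>) (A0_set r)) \<longlongrightarrow> 0) (at_right 0)"
      using \<epsilon>0 \<delta> ex1 pointwise hausdorff dynamics
      by (intro exI[of _ \<epsilon>0] exI[of _ \<delta>] conjI ballI allI) simp_all
  qed
qed

end
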